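(* Let $\mathcal{F}$ be a Fraïssé structure in a relational language which has the Henson property and the Hrushovski property, and such that $\mathrm{Age}(\mathcal{F})$ has the free joint embedding property. Let $G=\mathrm{Aut}(\mathcal{F})$, let $\mathcal{A}\subseteq\mathrm{RUC}_b(G)$ be the algebra of tame functions, and let $\varepsilon>0$. Then $\mathcal{F}$ has the Ramsey property up to $2\varepsilon$ for the finite colourings in $(\mathcal{A})_\varepsilon$: for all $A,B\in\mathrm{Age}(\mathcal{F})$ and every finite set $C$ of finite colourings of $\binom{\mathcal{F}}{A}$ which belong to $(\mathcal{A})_\varepsilon$, there exists $h\in\binom{\mathcal{F}}{B}$ such that for every $\chi\in C$ and all $a,a'\in\binom{B}{A}$, $|\chi(h\circ a)-\chi(h\circ a')|\le 2\varepsilon$.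
   Context: A Fraïssé structure is a countable relational structure $\mathcal{F}$ which is ultrahomogeneous (every isomorphism between finite substructures extends to an automorphism); $\mathrm{Age}(\mathcal{F})$ is the class of finite structures embeddable in $\mathcal{F}$. Free joint embedding property: for $A,B\in\mathrm{Age}(\mathcal{F})$ the disjoint union $A\sqcup B$ with no relations other than those of $A$ and those of $B$ is in $\mathrm{Age}(\mathcal{F})$. Henson property: for every countable structure $A$ embeddable in $\mathcal{F}$ there is an embedding $h\colon A\to\mathcal{F}$ such that every automorphism of the substructure $h(A)$ extends to an automorphism of $\mathcal{F}$. Hrushovski property: for every $A\in\mathrm{Age}(\mathcal{F})$ there are $B\in\mathrm{Age}(\mathcal{F})$ and an embedding $h\colon A\to B$ such that every partial isomorphism between substructures of $h(A)$ extends to an automorphism of $B$. $G$ carries the pointwise convergence topology. $\binom{Y}{A}$ is the set of embeddings of $A$ into $Y$. A colouring of $\binom{\mathcal{F}}{A}$ is a function $\chi\colon\binom{\mathcal{F}}{A}\to\mathbb R$, finite if its image is finite; fixing $a_0\in\binom{\mathcal{F}}{A}$, $\chi$ is identified with $\bar\chi\colon G\to\mathbb R$, $\bar\chi(g)=\chi(g\circ a_0)$. $G$ acts on itself by left multiplication. $\mathrm{RUC}_b(G)$ is the algebra of bounded $f\colon G\to\mathbb R$ such that for every $\delta>0$ there is a neighbourhood $U$ of the identity with $|f(g^{-1}x)-f(x)|<\delta$ for $g\in U$, $x\in G$, with the sup norm. A $G$-compactification of $G$ is a dense embedding $\nu\colon G\to Y$ into a compact space $Y$ to which the left action extends continuously;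 $f$ comes from $\nu$ if $f=\tilde f\circ\nu$ with $\tilde f$ continuous on $Y$. For a compact $G$-space $Y$ and $A_0,A_1\subseteq Y$, an independence set for $\{A_0,A_1\}$ is $I\subseteq G$ with $\bigcap_{j\in J}j^{-1}A_{\sigma(j)}\ne\varnothing$ for all finite $J\subseteq I$, $\sigma\colon J\to\{0,1\}$; an IT-pair is $(x,y)\in Y^2$ such that for all neighbourhoods $U_0\ni x,U_1\ni y$, $\{U_0,U_1\}$ has an infinite independence set; $Y$ is tame if no continuous $f$ on $Y$ and IT-pair $(x,y)$, $x\ne y$, have $f(x)\ne f(y)$. $f\in\mathrm{RUC}_b(G)$ is tame if it comes from a $G$-compactification $\nu\colon G\to Y$ with $Y$ tame. $(\mathcal{A})_\varepsilon$ is the set of functions at sup-distance less than $\varepsilon$ from $\mathcal{A}$. *)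

theory Defs
  imports "HOL-Analysis.Analysis" "HOL-Algebra.Bij" "HOL-Algebra.Group_Action"
begin

section \<open>Relational structures\<close>

text \<open>The language is given by a type \<open>'r\<close> of relation symbols and an arity function.\<close>

record ('r, 'a) struc =
  univ :: "'a set"
  interp :: "'r \<Rightarrow> 'a list set"

definition is_structure :: "('r \<Rightarrow> nat) \<Rightarrow> ('r, 'a) struc \<Rightarrow> bool" where
  "is_structure ar A \<longleftrightarrow> (\<forall>R. \<forall>xs \<in> interp A R. length xs = ar R \<and> set xs \<subseteq> univ A)"

definition induced :: "('r, 'a) struc \<Rightarrow> 'a set \<Rightarrow> ('r, 'a) struc" where
  "induced A X = \<lparr>univ = X, interp = (\<lambda>R. {xs \<in> interp A R. set xs \<subseteq> X})\<rparr>"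

text \<open>Maps between structures are extensional functions, so that two maps are equal iff they agree
  on the universe of the source.\<close>

definition embeddings :: "('r, 'a) struc \<Rightarrow> ('r, 'b) struc \<Rightarrow> ('a \<Rightarrow> 'b) set" where
  "embeddings A Y = {f \<in> univ A \<rightarrow>\<^sub>E univ Y. inj_on f (univ A) \<and>
     (\<forall>R xs. set xs \<subseteq> univ A \<longrightarrow> (xs \<in> interp A R \<longleftrightarrow> map f xs \<in> interp Y R))}"

definition isomorphisms :: "('r, 'a) struc \<Rightarrow> ('r, 'b) struc \<Rightarrow> ('a \<Rightarrow> 'b) set" where
  "isomorphisms A B = {f \<in> embeddings A B. f ` univ A = univ B}"

abbreviation automorphisms :: "('r, 'a) struc \<Rightarrow> ('a \<Rightarrow> 'a) set" where
  "automorphisms A \<equiv> isomorphisms A A"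

definition age :: "('r \<Rightarrow> nat) \<Rightarrow> ('r, 'a) struc \<Rightarrow> ('r, 'b) struc set" where
  "age ar F = {A. is_structure ar A \<and> finite (univ A) \<and> embeddings A F \<noteq> {}}"

definition disjoint_union :: "('r, 'a) struc \<Rightarrow> ('r, 'b) struc \<Rightarrow> ('r, 'a + 'b) struc" where
  "disjoint_union A B = \<lparr>univ = univ A <+> univ B,
     interp = (\<lambda>R. map Inl ` interp A R \<union> map Inr ` interp B R)\<rparr>"

definition ultrahomogeneous :: "('r, 'a) struc \<Rightarrow> bool" where
  "ultrahomogeneous F \<longleftrightarrow>
     (\<forall>X Y p. X \<subseteq> univ F \<and> Y \<subseteq> univ F \<and> finite X \<and> finite Y \<and>
        p \<in> isomorphisms (induced F X) (induced F Y) \<longrightarrow>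
        (\<exists>g \<in> automorphisms F. \<forall>x \<in> X. g x = p x))"

definition fraisse_structure :: "('r \<Rightarrow> nat) \<Rightarrow> ('r, 'a) struc \<Rightarrow> bool" where
  "fraisse_structure ar F \<longleftrightarrow> is_structure ar F \<and> countable (univ F) \<and> ultrahomogeneous F"

text \<open>The next three properties quantify over finite or countable structures. They are invariant
  under isomorphism, and every countable structure is isomorphic to one whose universe is a set of
  natural numbers; hence the quantifiers range over structures on subsets of \<^typ>\<open>nat\<close>.\<close>

definition free_joint_embedding :: "('r \<Rightarrow> nat) \<Rightarrow> ('r, 'a) struc \<Rightarrow> bool" where
  "free_joint_embedding ar F \<longleftrightarrow>
     (\<forall>A \<in> age ar F. \<forall>B \<in> age ar F.
        disjoint_union (A :: ('r, nat) struc) (B :: ('r, nat) struc) \<in> age ar F)"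

definition henson :: "('r \<Rightarrow> nat) \<Rightarrow> ('r, 'a) struc \<Rightarrow> bool" where
  "henson ar F \<longleftrightarrow>
     (\<forall>A :: ('r, nat) struc. is_structure ar A \<and> countable (univ A) \<and> embeddings A F \<noteq> {} \<longrightarrow>
        (\<exists>h \<in> embeddings A F. \<forall>s \<in> automorphisms (induced F (h ` univ A)).
           \<exists>g \<in> automorphisms F. \<forall>x \<in> h ` univ A. g x = s x))"

definition hrushovski :: "('r \<Rightarrow> nat) \<Rightarrow> ('r, 'a) struc \<Rightarrow> bool" where
  "hrushovski ar F \<longleftrightarrow>
     (\<forall>A :: ('r, nat) struc. A \<in> age ar F \<longrightarrow>
        (\<exists>B :: ('r, nat) struc. B \<in> age ar F \<and>
           (\<exists>h \<in> embeddings A B. \<forall>X Y p. X \<subseteq> h ` univ A \<and> Y \<subseteq> h ` univ A \<and>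
              p \<in> isomorphisms (induced B X) (induced B Y) \<longrightarrow>
              (\<exists>t \<in> automorphisms B. \<forall>x \<in> X. t x = p x))))"

section \<open>The automorphism group\<close>

definition aut_group :: "('r, 'a) struc \<Rightarrow> ('a \<Rightarrow> 'a) monoid" where
  "aut_group F = (BijGroup (univ F))\<lparr>carrier := automorphisms F\<rparr>"

text \<open>Pointwise convergence: the universe of the structure is discrete.\<close>

definition aut_topology :: "('r, 'a) struc \<Rightarrow> ('a \<Rightarrow> 'a) topology" where
  "aut_topology F = subtopology
     (product_topology (\<lambda>_. discrete_topology (univ F)) (univ F)) (automorphisms F)"

lemma topspace_aut_topology: "topspace (aut_topology F) = carrier (aut_group F)"
  by (auto simp: aut_topology_def aut_group_def isomorphisms_def embeddings_def)

section \<open>Tame functions on a topological group\<close>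

text \<open>Throughout, \<open>G\<close> is a group and \<open>T\<close> is its topology. Real functions on \<open>G\<close> are extensional,
  and bounded ones are points of the library's metric space \<^term>\<open>funspace (carrier G) euclidean_metric\<close>,
  whose metric is the sup distance.\<close>

definition RUCb :: "('g, 'm) monoid_scheme \<Rightarrow> 'g topology \<Rightarrow> ('g \<Rightarrow> real) set" where
  "RUCb G T = {f \<in> mspace (funspace (carrier G) euclidean_metric).
     \<forall>\<delta>>0. \<exists>U. openin T U \<and> \<one>\<^bsub>G\<^esub> \<in> U \<and>
       (\<forall>g\<in>U. \<forall>x\<in>carrier G. \<bar>f (inv\<^bsub>G\<^esub> g \<otimes>\<^bsub>G\<^esub> x) - f x\<bar> < \<delta>)}"

definition continuous_action ::
  "('g, 'm) monoid_scheme \<Rightarrow> 'g topology \<Rightarrow> 'y topology \<Rightarrow> ('g \<Rightarrow> 'y \<Rightarrow> 'y) \<Rightarrow> bool" where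
  "continuous_action G T Y \<phi> \<longleftrightarrow> group_action G (topspace Y) \<phi> \<and>
     continuous_map (prod_topology T Y) Y (\<lambda>(g, y). \<phi> g y)"

text \<open>Compact spaces are Hausdorff.\<close>

definition compactification ::
  "('g, 'm) monoid_scheme \<Rightarrow> 'g topology \<Rightarrow> ('g \<Rightarrow> 'y) \<Rightarrow> 'y topology \<Rightarrow> ('g \<Rightarrow> 'y \<Rightarrow> 'y) \<Rightarrow> bool" where
  "compactification G T \<nu> Y \<phi> \<longleftrightarrow>
     compact_space Y \<and> Hausdorff_space Y \<and> continuous_action G T Y \<phi> \<and>
     embedding_map T Y \<nu> \<and> Y closure_of (\<nu> ` carrier G) = topspace Y \<and>
     (\<forall>g\<in>carrier G. \<forall>x\<in>carrier G. \<phi> g (\<nu> x) = \<nu> (g \<otimes>\<^bsub>G\<^esub> x))"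

definition independence_set ::
  "('g, 'm) monoid_scheme \<Rightarrow> 'y topology \<Rightarrow> ('g \<Rightarrow> 'y \<Rightarrow> 'y) \<Rightarrow> 'y set \<Rightarrow> 'y set \<Rightarrow> 'g set \<Rightarrow> bool" where
  "independence_set G Y \<phi> A0 A1 I \<longleftrightarrow> I \<subseteq> carrier G \<and>
     (\<forall>J \<sigma>. finite J \<and> J \<subseteq> I \<longrightarrow>
        topspace Y \<inter> (\<Inter>j\<in>J. \<phi> (inv\<^bsub>G\<^esub> j) ` (if \<sigma> j then A1 else A0)) \<noteq> {})"

definition IT_pair ::
  "('g, 'm) monoid_scheme \<Rightarrow> 'y topology \<Rightarrow> ('g \<Rightarrow> 'y \<Rightarrow> 'y) \<Rightarrow> 'y \<Rightarrow> 'y \<Rightarrow> bool" where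
  "IT_pair G Y \<phi> x y \<longleftrightarrow> x \<in> topspace Y \<and> y \<in> topspace Y \<and>
     (\<forall>U0 U1. openin Y U0 \<and> openin Y U1 \<and> x \<in> U0 \<and> y \<in> U1 \<longrightarrow>
        (\<exists>I. infinite I \<and> independence_set G Y \<phi> U0 U1 I))"

definition tame_space ::
  "('g, 'm) monoid_scheme \<Rightarrow> 'y topology \<Rightarrow> ('g \<Rightarrow> 'y \<Rightarrow> 'y) \<Rightarrow> bool" where
  "tame_space G Y \<phi> \<longleftrightarrow>
     \<not> (\<exists>f x y. continuous_map Y euclideanreal f \<and> IT_pair G Y \<phi> x y \<and> x \<noteq> y \<and> f x \<noteq> f y)"

text \<open>A point \<open>y\<close> of a Hausdorff compactification \<open>\<nu>\<close> is determined by the set of all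
  \<open>\<nu>\<^sup>-\<^sup>1(U)\<close>, where \<open>U\<close> is a neighbourhood of \<open>y\<close>. Hence every compactification has
  an isomorphic copy whose points are sets of subsets of \<open>G\<close>, and it is enough to quantify over
  spaces of that type; see \<open>tame_functionsI\<close> below.\<close>

definition tame_functions :: "('g, 'm) monoid_scheme \<Rightarrow> 'g topology \<Rightarrow> ('g \<Rightarrow> real) set" where
  "tame_functions G T = {f \<in> RUCb G T.
     \<exists>(Y :: 'g set set topology) \<phi> \<nu> f'. compactification G T \<nu> Y \<phi> \<and> tame_space G Y \<phi> \<and>
       continuous_map Y euclideanreal f' \<and> (\<forall>x\<in>carrier G. f x = f' (\<nu> x))}"

definition sup_nbhd ::
  "('g, 'm) monoid_scheme \<Rightarrow> ('g \<Rightarrow> real) set \<Rightarrow> real \<Rightarrow> ('g \<Rightarrow> real) set" where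
  "sup_nbhd G \<A> \<epsilon> = {f \<in> mspace (funspace (carrier G) euclidean_metric).
     \<exists>h\<in>\<A>. mdist (funspace (carrier G) euclidean_metric) f h < \<epsilon>}"

section \<open>Colourings\<close>

definition finite_colouring ::
  "('r, 'a) struc \<Rightarrow> ('r, 'b) struc \<Rightarrow> (('b \<Rightarrow> 'a) \<Rightarrow> real) \<Rightarrow> bool" where
  "finite_colouring F A c \<longleftrightarrow> c \<in> extensional (embeddings A F) \<and> finite (c ` embeddings A F)"

definition colouring_on_group ::
  "('r, 'a) struc \<Rightarrow> ('r, 'b) struc \<Rightarrow> ('b \<Rightarrow> 'a) \<Rightarrow> (('b \<Rightarrow> 'a) \<Rightarrow> real) \<Rightarrow> ('a \<Rightarrow> 'a) \<Rightarrow> real" where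
  "colouring_on_group F A a0 c = (\<lambda>g \<in> carrier (aut_group F). c (compose (univ A) g a0))"

section \<open>Independence of the type of the compactification\<close>

lemma embedding_map_mem:
  assumes "embedding_map X Y f" "x \<in> topspace X"
  shows "f x \<in> topspace Y"
proof -
  have "continuous_map X (subtopology Y (f ` topspace X)) f"
    using assms by (simp add: embedding_map_def homeomorphic_imp_continuous_map)
  then show ?thesis
    using assms(2) by (auto simp: continuous_map_def topspace_subtopology)
qed

lemma compactification_transfer:
  assumes c: "compactification G T \<nu> Y \<phi>" and h: "homeomorphic_maps Y Z e e'"
    and T: "topspace T = carrier G"
  shows "compactification G T (e \<circ> \<nu>) Z (\<lambda>g. \<lambda>z\<in>topspace Z. e (\<phi> g (e' z)))"
proof -
  let ?\<psi> = "\<lambda>g. \<lambda>z\<in>topspace Z. e (\<phi> g (e' z))"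
  have cp: "compact_space Y" "Hausdorff_space Y" "group_action G (topspace Y) \<phi>"
    and ct: "continuous_map (prod_topology T Y) Y (\<lambda>(g, y). \<phi> g y)"
    and em: "embedding_map T Y \<nu>" and de: "Y closure_of (\<nu> ` carrier G) = topspace Y"
    and eq: "\<And>g x. g \<in> carrier G \<Longrightarrow> x \<in> carrier G \<Longrightarrow> \<phi> g (\<nu> x) = \<nu> (g \<otimes>\<^bsub>G\<^esub> x)"
    using c unfolding compactification_def continuous_action_def by auto
  have ce: "continuous_map Y Z e" and ce': "continuous_map Z Y e'"
    and ee: "\<And>y. y \<in> topspace Y \<Longrightarrow> e' (e y) = y" "\<And>z. z \<in> topspace Z \<Longrightarrow> e (e' z) = z"
    using h unfolding homeomorphic_maps_def by auto
  have hm: "homeomorphic_map Y Z e" using h homeomorphic_maps_map by blast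
  have hs: "Y homeomorphic_space Z" using h homeomorphic_space_def by blast
  have eY: "e y \<in> topspace Z" if "y \<in> topspace Y" for y
    using ce that by (meson continuous_map_image_subset_topspace image_subset_iff)
  have eZ: "e' z \<in> topspace Y" if "z \<in> topspace Z" for z
    using ce' that by (meson continuous_map_image_subset_topspace image_subset_iff)
  have nT: "\<nu> x \<in> topspace Y" if "x \<in> carrier G" for x
    using embedding_map_mem [OF em] T that by blast
  interpret group_action G "topspace Y" \<phi> by (rule cp)
  have el: "\<phi> g y \<in> topspace Y" if "g \<in> carrier G" "y \<in> topspace Y" for g y
    using that element_image by blast
  have G: "group G" using group_hom by (simp add: group_hom_def)
  have cr: "\<phi> (g \<otimes>\<^bsub>G\<^esub> g') y = \<phi> g (\<phi> g' y)"
    if "g \<in> carrier G" "g' \<in> carrier G" "y \<in> topspace Y" for g g' y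
    using that composition_rule by blast
  have bij: "?\<psi> g \<in> Bij (topspace Z)" if g: "g \<in> carrier G" for g
  proof -
    have "bij_betw (\<phi> g) (topspace Y) (topspace Y)" using bij_prop0 [OF g] by (simp add: Bij_def)
    moreover have "bij_betw e (topspace Y) (topspace Z)"
      by (rule bij_betwI [where g=e']) (use ee eY eZ in auto)
    moreover have "bij_betw e' (topspace Z) (topspace Y)"
      by (rule bij_betwI [where g=e]) (use ee eY eZ in auto)
    ultimately have "bij_betw (e \<circ> \<phi> g \<circ> e') (topspace Z) (topspace Z)"
      by (meson bij_betw_trans)
    moreover have "bij_betw (?\<psi> g) (topspace Z) (topspace Z) =
        bij_betw (e \<circ> \<phi> g \<circ> e') (topspace Z) (topspace Z)"
      by (rule bij_betw_cong) auto
    ultimately show ?thesis by (simp add: Bij_def)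
  qed
  have ga: "group_action G (topspace Z) ?\<psi>"
  proof (unfold group_action_def group_hom_def group_hom_axioms_def, intro conjI G group_BijGroup homI)
    fix x y assume xy: "x \<in> carrier G" "y \<in> carrier G"
    have "?\<psi> (x \<otimes>\<^bsub>G\<^esub> y) = compose (topspace Z) (?\<psi> x) (?\<psi> y)"
      by (rule ext) (use xy in \<open>auto simp: compose_def restrict_def cr eZ eY el ee\<close>)
    then show "?\<psi> (x \<otimes>\<^bsub>G\<^esub> y) = ?\<psi> x \<otimes>\<^bsub>BijGroup (topspace Z)\<^esub> ?\<psi> y"
      using bij xy by (simp add: BijGroup_def)
  qed (use bij in \<open>simp add: BijGroup_def\<close>)
  have "continuous_map (prod_topology T Z) (prod_topology T Y) (\<lambda>p. (fst p, e' (snd p)))"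
    by (intro continuous_map_pairedI continuous_map_fst continuous_map_compose [OF continuous_map_snd ce', unfolded o_def])
  then have "continuous_map (prod_topology T Z) Z (e \<circ> ((\<lambda>(g, y). \<phi> g y) \<circ> (\<lambda>p. (fst p, e' (snd p)))))"
    by (intro continuous_map_compose [OF _ ce] continuous_map_compose [OF _ ct])
  then have ca: "continuous_map (prod_topology T Z) Z (\<lambda>(g, z). ?\<psi> g z)"
    by (rule continuous_map_eq) auto
  have "embedding_map T Z (e \<circ> \<nu>)"
    using em hm by (meson embedding_map_compose surjective_embedding_map)
  moreover have "Z closure_of ((e \<circ> \<nu>) ` carrier G) = topspace Z"
  proof -
    have "Z closure_of (e ` (\<nu> ` carrier G)) = e ` (Y closure_of (\<nu> ` carrier G))"
      using hm nT by (intro homeomorphic_map_closure_of) auto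
    also have "\<dots> = topspace Z" using de hm homeomorphic_imp_surjective_map by fastforce
    finally show ?thesis by (simp add: image_comp)
  qed
  moreover have "compact_space Z" "Hausdorff_space Z"
    using cp hs homeomorphic_compact_space homeomorphic_Hausdorff_space by blast+
  moreover have "\<forall>g\<in>carrier G. \<forall>x\<in>carrier G. ?\<psi> g ((e \<circ> \<nu>) x) = (e \<circ> \<nu>) (g \<otimes>\<^bsub>G\<^esub> x)"
    using eq by (simp add: nT ee eY)
  ultimately show ?thesis
    using ga ca unfolding compactification_def continuous_action_def by blast
qed

lemma tame_space_transfer:
  assumes t: "tame_space G Y \<phi>" and h: "homeomorphic_maps Y Z e e'"
    and ga: "group_action G (topspace Y) \<phi>"
  shows "tame_space G Z (\<lambda>g. \<lambda>z\<in>topspace Z. e (\<phi> g (e' z)))"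
proof -
  let ?\<psi> = "\<lambda>g. \<lambda>z\<in>topspace Z. e (\<phi> g (e' z))"
  have ce: "continuous_map Y Z e" and ce': "continuous_map Z Y e'"
    and ee: "\<And>y. y \<in> topspace Y \<Longrightarrow> e' (e y) = y" "\<And>z. z \<in> topspace Z \<Longrightarrow> e (e' z) = z"
    using h unfolding homeomorphic_maps_def by auto
  have eY: "e y \<in> topspace Z" if "y \<in> topspace Y" for y
    using ce that by (meson continuous_map_image_subset_topspace image_subset_iff)
  have eZ: "e' z \<in> topspace Y" if "z \<in> topspace Z" for z
    using ce' that by (meson continuous_map_image_subset_topspace image_subset_iff)
  interpret group_action G "topspace Y" \<phi> by (rule ga)
  have el: "\<phi> g y \<in> topspace Y" if "g \<in> carrier G" "y \<in> topspace Y" for g y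
    using that element_image by blast
  have G: "group G" using group_hom by (simp add: group_hom_def)
  have IT: "IT_pair G Y \<phi> (e' x) (e' y)" if it: "IT_pair G Z ?\<psi> x y" for x y
    unfolding IT_pair_def
  proof (intro conjI allI impI)
    show "e' x \<in> topspace Y" "e' y \<in> topspace Y" using it eZ by (auto simp: IT_pair_def)
    fix U0 U1 assume U: "openin Y U0 \<and> openin Y U1 \<and> e' x \<in> U0 \<and> e' y \<in> U1"
    let ?V = "\<lambda>U. {z \<in> topspace Z. e' z \<in> U}"
    have "openin Z (?V U0)" "openin Z (?V U1)" "x \<in> ?V U0" "y \<in> ?V U1"
      using U ce' it by (auto simp: openin_continuous_map_preimage IT_pair_def)
    then obtain I where I: "infinite I" "independence_set G Z ?\<psi> (?V U0) (?V U1) I"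
      using it unfolding IT_pair_def by blast
    have "independence_set G Y \<phi> U0 U1 I"
      unfolding independence_set_def
    proof (intro conjI allI impI)
      show IG: "I \<subseteq> carrier G" using I by (simp add: independence_set_def)
      fix J and \<sigma> :: "'a \<Rightarrow> bool" assume J: "finite J \<and> J \<subseteq> I"
      then have "topspace Z \<inter> (\<Inter>j\<in>J. ?\<psi> (inv\<^bsub>G\<^esub> j) ` (if \<sigma> j then ?V U1 else ?V U0)) \<noteq> {}"
        using I(2) unfolding independence_set_def by blast
      then obtain z where z: "z \<in> topspace Z"
        "\<And>j. j \<in> J \<Longrightarrow> z \<in> ?\<psi> (inv\<^bsub>G\<^esub> j) ` (if \<sigma> j then ?V U1 else ?V U0)" by blast
      have "e' z \<in> \<phi> (inv\<^bsub>G\<^esub> j) ` (if \<sigma> j then U1 else U0)" if j: "j \<in> J" for j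
      proof -
        have jG: "inv\<^bsub>G\<^esub> j \<in> carrier G" using j J IG G by (meson group.inv_closed subsetD)
        obtain w where w: "w \<in> (if \<sigma> j then ?V U1 else ?V U0)" "z = ?\<psi> (inv\<^bsub>G\<^esub> j) w"
          using z(2) [OF j] by blast
        have wZ: "w \<in> topspace Z" "e' w \<in> (if \<sigma> j then U1 else U0)"
          using w(1) by (auto split: if_splits)
        have "e' z = \<phi> (inv\<^bsub>G\<^esub> j) (e' w)" using w(2) wZ ee el jG eZ by simp
        then show ?thesis using wZ by blast
      qed
      then show "topspace Y \<inter> (\<Inter>j\<in>J. \<phi> (inv\<^bsub>G\<^esub> j) ` (if \<sigma> j then U1 else U0)) \<noteq> {}"
        using eZ z(1) by blast
    qed
    then show "\<exists>I. infinite I \<and> independence_set G Y \<phi> U0 U1 I" using I(1) by blast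
  qed
  show ?thesis
    unfolding tame_space_def
  proof clarify
    fix f x y
    assume f: "continuous_map Z euclideanreal f" and it: "IT_pair G Z ?\<psi> x y" and ne: "f x \<noteq> f y"
    have xy: "x \<in> topspace Z" "y \<in> topspace Z" using it by (auto simp: IT_pair_def)
    have "continuous_map Y euclideanreal (f \<circ> e)" using f ce continuous_map_compose by blast
    moreover have "(f \<circ> e) (e' x) \<noteq> (f \<circ> e) (e' y)" using ne xy ee by simp
    moreover have "e' x \<noteq> e' y" using ne xy ee by metis
    ultimately show False using t IT [OF it] unfolding tame_space_def by blast
  qed
qed

lemma tame_functionsI:
  fixes Y :: "'y topology"
  assumes f: "f \<in> RUCb G T" and c: "compactification G T \<nu> Y \<phi>" and t: "tame_space G Y \<phi>"
    and f': "continuous_map Y euclideanreal f'" "\<forall>x\<in>carrier G. f x = f' (\<nu> x)"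
    and T: "topspace T = carrier G"
  shows "f \<in> tame_functions G T"
proof -
  define e where "e y = {{x \<in> carrier G. \<nu> x \<in> U} | U. openin Y U \<and> y \<in> U}" for y
  define e' where "e' = inv_into (topspace Y) e"
  define Z where "Z = pullback_topology (e ` topspace Y) e' Y"
  have Hd: "Hausdorff_space Y" and de: "Y closure_of (\<nu> ` carrier G) = topspace Y"
    and ga: "group_action G (topspace Y) \<phi>" and em: "embedding_map T Y \<nu>"
    using c by (auto simp: compactification_def continuous_action_def)
  have nT: "\<nu> x \<in> topspace Y" if "x \<in> carrier G" for x
    using embedding_map_mem [OF em] T that by blast
  have inj: "inj_on e (topspace Y)"
  proof (rule inj_onI, rule ccontr)
    fix y y' assume y: "y \<in> topspace Y" "y' \<in> topspace Y" and eq: "e y = e y'" and ne: "y \<noteq> y'"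
    then obtain U V where U: "openin Y U" "openin Y V" "y \<in> U" "y' \<in> V" "disjnt U V"
      using Hd unfolding Hausdorff_space_def by metis
    then have "{x \<in> carrier G. \<nu> x \<in> U} \<in> e y'" using eq unfolding e_def by blast
    then obtain W where W: "openin Y W" "y' \<in> W" "{x \<in> carrier G. \<nu> x \<in> U} = {x \<in> carrier G. \<nu> x \<in> W}"
      unfolding e_def by blast
    have "openin Y (V \<inter> W)" "y' \<in> V \<inter> W" "y' \<in> Y closure_of (\<nu> ` carrier G)"
      using U W y de by auto
    then obtain x where "x \<in> carrier G" "\<nu> x \<in> V \<inter> W"
      unfolding in_closure_of by blast
    then show False using W(3) U(5) by (auto simp: disjnt_def)
  qed
  have e'e: "e' (e y) = y" if "y \<in> topspace Y" for y
    using inj that by (simp add: e'_def)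
  have tZ: "topspace Z = e ` topspace Y"
    using e'e by (auto simp: Z_def topspace_pullback_topology)
  have "continuous_map Y Z e"
    unfolding Z_def
  proof (rule continuous_map_pullback')
    show "continuous_map Y Y (e' \<circ> e)"
      by (rule continuous_map_eq [OF continuous_map_id]) (simp add: e'e)
  qed auto
  moreover have "continuous_map Z Y e'"
    using continuous_map_pullback [OF continuous_map_id [of Y], of "e ` topspace Y" e'] by (simp add: Z_def)
  ultimately have h: "homeomorphic_maps Y Z e e'"
    unfolding homeomorphic_maps_def using e'e tZ by auto
  let ?\<psi> = "\<lambda>g. \<lambda>z\<in>topspace Z. e (\<phi> g (e' z))"
  have "compactification G T (e \<circ> \<nu>) Z ?\<psi>" "tame_space G Z ?\<psi>"
    using compactification_transfer [OF c h T] tame_space_transfer [OF t h ga] by auto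
  moreover have "continuous_map Z euclideanreal (f' \<circ> e')"
    using \<open>continuous_map Z Y e'\<close> f'(1) by (rule continuous_map_compose)
  moreover have "\<forall>x\<in>carrier G. f x = (f' \<circ> e') ((e \<circ> \<nu>) x)"
    using f'(2) nT e'e by simp
  ultimately show ?thesis using f unfolding tame_functions_def by blast
qed

end

theory Submission
  imports Defs
begin

text \<open>Suppose that every copy of \<open>B\<close> in \<open>F\<close> is bad, that is, some colouring in \<open>C\<close> takes values more than
  \<open>2\<epsilon>\<close> apart on two copies \<open>a\<close>, \<open>a'\<close> of \<open>A\<close> in it. By the Hrushovski property we may assume that an
  automorphism of \<open>B\<close> maps \<open>a\<close> to \<open>a'\<close>. By free joint embedding and homogeneity the disjoint
  union of infinitely many copies of \<open>B\<close> embeds into \<open>F\<close>, and by the Henson property we can embed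
  it so that the exchange of \<open>a\<close> and \<open>a'\<close> in any prescribed set of copies is induced by an element of
  \<open>G\<close>. By the pigeonhole principle we may assume that the colouring, \<open>a\<close>, \<open>a'\<close> and the two values
  \<open>\<alpha>\<close>, \<open>\<beta>\<close> are the same in all copies. Exchanging in the \<open>n\<close>-th copies with \<open>k\<close> in the \<open>n\<close>-th finite set of
  naturals, for \<open>k = 0, 1, \<dots>\<close>, gives an infinite independence set for the closed sets on which the
  tame function that approximates the colouring is \<open>\<epsilon>\<close>-close to \<open>\<alpha>\<close> and \<open>\<beta>\<close>. Such a set yields an IT-pair
  with one point in each of these disjoint sets, contradicting tameness.\<close>

section \<open>IT-pairs from independence sets\<close>

text \<open>Zorn's lemma for proper filters below \<open>F\<close>, in reversed order: a minimal one
  either has trivial meet with \<open>P\<close>, which makes \<open>\<not> P\<close> eventual, or is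
  unchanged when \<open>P\<close> is added.\<close>

lemma ultrafilter_exists:
  assumes "F \<noteq> (bot :: 'a filter)"
  obtains U where "U \<le> F" "U \<noteq> bot" "\<And>P. eventually P U \<or> eventually (\<lambda>x. \<not> P x) U"
proof -
  let ?S = "{U. U \<le> F \<and> U \<noteq> bot}"
  have "\<exists>U\<in>?S. \<forall>V\<in>?S. V \<le> U \<longrightarrow> V = U"
  proof (rule predicate_Zorn)
    show "partial_order_on ?S (relation_of (\<lambda>U V. V \<le> U) ?S)"
      by (rule partial_order_on_relation_ofI) auto
    fix C assume C: "C \<in> Chains (relation_of (\<lambda>U V. V \<le> U) ?S)"
    then have CS: "C \<subseteq> ?S" and ch: "\<And>U V. U \<in> C \<Longrightarrow> V \<in> C \<Longrightarrow> U \<le> V \<or> V \<le> U"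
      by (auto simp: Chains_def relation_of_def)
    show "\<exists>U\<in>?S. \<forall>V\<in>C. U \<le> V"
    proof (cases "C = {}")
      case True
      then show ?thesis using assms by auto
    next
      case False
      \<comment> \<open>What holds eventually in the infimum of a nonempty chain already holds
        eventually in a member, so a trivial infimum would need a trivial member.\<close>
      have "Inf C \<noteq> bot"
      proof
        assume "Inf C = bot"
        moreover have "eventually (\<lambda>_. False) (Inf C) \<longleftrightarrow> (\<exists>b\<in>C. eventually (\<lambda>_. False) b)"
          using False by (rule eventually_Inf_base) (meson ch inf_greatest order_refl)
        ultimately show False using CS by (auto simp: trivial_limit_def)
      qed
      moreover have "Inf C \<le> F"
      proof -
        obtain V where "V \<in> C" using False by blast
        then show ?thesis using CS Inf_lower order_trans by blast
      qed
      ultimately show ?thesis by (intro bexI[of _ "Inf C"]) (auto intro: Inf_lower)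
    qed
  qed
  then obtain U where U: "U \<le> F" "U \<noteq> bot" "\<And>V. V \<le> F \<Longrightarrow> V \<noteq> bot \<Longrightarrow> V \<le> U \<Longrightarrow> V = U"
    by blast
  have "eventually P U \<or> eventually (\<lambda>x. \<not> P x) U" for P
  proof (cases "inf U (principal {x. P x}) = bot")
    case True
    then have "eventually (\<lambda>_. False) (inf U (principal {x. P x}))" by simp
    then show ?thesis by (simp add: eventually_inf_principal)
  next
    case False
    then have "inf U (principal {x. P x}) = U" using U by (meson inf.cobounded1 order_trans)
    moreover have "eventually P (inf U (principal {x. P x}))" by (simp add: eventually_inf_principal)
    ultimately show ?thesis by simp
  qed
  then show ?thesis using U that by blast
qed

text \<open>Fix a free ultrafilter \<open>p\<close> on \<open>I\<close> and call a set \<open>Z\<close> of columns \<open>full\<close> if the rows in some member of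
  \<open>p\<close> are independent over \<open>Z\<close>. When a full set is split into finitely many pieces, one of them is
  full. Hence for \<open>p\<close>-many rows some colour can be prescribed so that \<open>Z\<close> stays full, and if the
  number of colours that can be so prescribed is minimal for \<open>Z\<close>, then the same colour works for all
  full subsets of \<open>Z\<close>. Thus the rows of \<open>I'\<close> can be chosen one at a time.\<close>

lemma independence_ramsey:
  fixes P :: "bool \<Rightarrow> 'i \<Rightarrow> 'x \<Rightarrow> bool" and \<kappa> :: "'i \<Rightarrow> 'x \<Rightarrow> 'c"
  assumes I: "infinite I" and C: "finite C" "\<And>i x. i \<in> I \<Longrightarrow> \<kappa> i x \<in> C"
    and ind: "\<And>J \<sigma>. finite J \<Longrightarrow> J \<subseteq> I \<Longrightarrow> \<exists>x. \<forall>j\<in>J. P (\<sigma> j) j x"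
  obtains I' c where "I' \<subseteq> I" "infinite I'"
    "\<And>J \<sigma>. finite J \<Longrightarrow> J \<subseteq> I' \<Longrightarrow> \<exists>x. \<forall>j\<in>J. P (\<sigma> j) j x \<and> \<kappa> j x = c (\<sigma> j)"
proof -
  \<comment> \<open>An ultrafilter below this filter contains \<open>I\<close> and no finite set, so
    finitely many rows may always be discarded.\<close>
  have "inf cofinite (principal I) \<noteq> bot"
    using I by (simp add: trivial_limit_def eventually_inf_principal eventually_cofinite)
  then obtain p where p: "p \<le> inf cofinite (principal I)" "p \<noteq> bot"
    and ultra: "\<And>Q. eventually Q p \<or> eventually (\<lambda>x. \<not> Q x) p"
    by (rule ultrafilter_exists) blast
  have cof: "eventually (\<lambda>i. i \<notin> J) p" if "finite J" for J
    using p(1) that by (simp add: le_filter_def eventually_inf_principal eventually_cofinite)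
  have evI: "eventually (\<lambda>i. i \<in> I) p"
    using p(1) by (simp add: le_filter_def eventually_inf_principal)
  define hit where "hit Z J \<sigma> \<longleftrightarrow> (\<exists>x\<in>Z. \<forall>j\<in>J. P (\<sigma> j) j x)" for Z J \<sigma>
  define indep where "indep Z M \<longleftrightarrow> (\<forall>J \<sigma>. finite J \<longrightarrow> J \<subseteq> M \<longrightarrow> hit Z J \<sigma>)" for Z M
  define big where "big M \<longleftrightarrow> eventually (\<lambda>i. i \<in> M) p" for M
  define full where "full Z \<longleftrightarrow> (\<exists>M. big M \<and> indep Z M)" for Z
  have full_mono: "full Z'" if "full Z" "Z \<subseteq> Z'" for Z Z'
  proof -
    have "hit Z' J \<sigma>" if "hit Z J \<sigma>" for J \<sigma>
      using that \<open>Z \<subseteq> Z'\<close> by (auto simp: hit_def)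
    then show ?thesis using \<open>full Z\<close> unfolding full_def indep_def by meson
  qed
  have full_Un: "full Z1 \<or> full Z2" if Z: "full (Z1 \<union> Z2)" for Z1 Z2
  proof (rule disjCI)
    assume "\<not> full Z2"
    obtain M where M: "big M" "indep (Z1 \<union> Z2) M"
      using Z unfolding full_def by blast
    have "\<not> indep Z2 M" using M(1) \<open>\<not> full Z2\<close> by (auto simp: full_def)
    then obtain J2 \<sigma>2 where J2: "finite J2" "J2 \<subseteq> M" "\<not> hit Z2 J2 \<sigma>2"
      by (auto simp: indep_def)
    show "full Z1"
      unfolding full_def indep_def
    proof (intro exI conjI allI impI)
      show "big (M - J2)"
        using eventually_conj[OF M(1)[unfolded big_def] cof[OF J2(1)]] by (simp add: big_def)
      fix J \<sigma> assume J: "finite J" "J \<subseteq> M - J2"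
      \<comment> \<open>The pattern on \<open>J2\<close> that no column of \<open>Z2\<close>
        realises is imposed together with the pattern on \<open>J\<close>; this forces the column
        into \<open>Z1\<close>.\<close>
      have "hit (Z1 \<union> Z2) (J \<union> J2) (\<lambda>j. if j \<in> J2 then \<sigma>2 j else \<sigma> j)"
        using M(2) J J2 by (simp add: indep_def subset_iff)
      then obtain x where x: "x \<in> Z1 \<union> Z2" "\<forall>j\<in>J \<union> J2. P (if j \<in> J2 then \<sigma>2 j else \<sigma> j) j x"
        unfolding hit_def by blast
      have "P (\<sigma>2 j) j x" if "j \<in> J2" for j using bspec[OF x(2), of j] that by auto
      then have "x \<in> Z1" using J2(3) x(1) unfolding hit_def by blast
      moreover have "P (\<sigma> j) j x" if "j \<in> J" for j using bspec[OF x(2), of j] that J by auto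
      ultimately show "hit Z1 J \<sigma>" unfolding hit_def by blast
    qed
  qed
  have full_empty: "\<not> full {}" by (auto simp: full_def indep_def hit_def)
  have full_UN: "\<exists>d\<in>D. full (Z d)" if "finite D" "full (\<Union>d\<in>D. Z d)" for D :: "'c set" and Z
    using that by (induction D) (use full_empty full_Un in auto)
  have full_row: "eventually (\<lambda>i. full {x \<in> Z. P v i x}) p" if "full Z" for Z v
  proof -
    obtain M where M: "big M" "indep Z M"
      using \<open>full Z\<close> unfolding full_def by blast
    have "full {x \<in> Z. P v i x}" if i: "i \<in> M" for i
      unfolding full_def indep_def
    proof (intro exI conjI allI impI)
      show "big (M - {i})"
        using eventually_conj[OF M(1)[unfolded big_def] cof[of "{i}"]] by (simp add: big_def)
      fix J \<sigma> assume J: "finite J" "J \<subseteq> M - {i}"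
      have "hit Z (insert i J) (\<sigma>(i := v))"
        using M(2) J i by (simp add: indep_def subset_iff)
      then obtain x where x: "x \<in> Z" "\<forall>j\<in>insert i J. P ((\<sigma>(i := v)) j) j x"
        unfolding hit_def by blast
      have "P (\<sigma> j) j x" if "j \<in> J" for j using bspec[OF x(2), of j] that J by (cases "j = i") auto
      moreover have "P v i x" using x(2) by simp
      ultimately show "hit {x \<in> Z. P v i x} J \<sigma>" using x(1) unfolding hit_def by auto
    qed
    then show ?thesis using M(1) unfolding big_def by (auto elim: eventually_mono)
  qed
  define good where "good Z v d i \<longleftrightarrow> full {x \<in> Z. P v i x \<and> \<kappa> i x = d}" for Z v d i
  define S where "S Z v = {d \<in> C. eventually (good Z v d) p}" for Z v
  have S_mono: "S Z v \<subseteq> S Z' v" if "Z \<subseteq> Z'" for Z Z' v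
  proof -
    have "good Z' v d i" if "good Z v d i" for d i
      using that \<open>Z \<subseteq> Z'\<close> unfolding good_def by (elim full_mono) auto
    then show ?thesis unfolding S_def by (auto elim: eventually_mono)
  qed
  have S_ne: "S Z v \<noteq> {}" if "full Z" for Z v
  proof
    assume "S Z v = {}"
    then have "\<forall>d\<in>C. eventually (\<lambda>i. \<not> good Z v d i) p"
      using ultra by (auto simp: S_def)
    \<comment> \<open>As \<open>C\<close> is finite, some single row would rule out all colours at
      once, although its colour classes split a full set into finitely many pieces.\<close>
    then have "eventually (\<lambda>i. \<forall>d\<in>C. \<not> good Z v d i) p"
      using C(1) by (simp add: eventually_ball_finite)
    with full_row[OF that, of v] evI have "eventually (\<lambda>i. False) p"
    proof eventually_elim
      case (elim i)
      have "{x \<in> Z. P v i x} = (\<Union>d\<in>C. {x \<in> Z. P v i x \<and> \<kappa> i x = d})"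
        using C(2)[OF elim(2)] by auto
      then show False using full_UN[OF C(1)] elim by (metis (no_types, lifting) good_def)
    qed
    then show False using p(2) by (simp add: trivial_limit_def)
  qed
  have "full UNIV" unfolding full_def indep_def hit_def using evI ind by (intro exI[of _ I]) (simp add: big_def)
  \<comment> \<open>Minimality of the sum and monotonicity of both summands make
    \<open>S Z v\<close> constant for full \<open>Z\<close> below \<open>Z0\<close>.\<close>
  then obtain Z0 where Z0: "full Z0"
    "\<And>Z. full Z \<Longrightarrow> card (S Z0 True) + card (S Z0 False) \<le> card (S Z True) + card (S Z False)"
    using ex_has_least_nat[of full UNIV "\<lambda>Z. card (S Z True) + card (S Z False)"] by blast
  have finS: "finite (S Z v)" for Z v using C(1) by (simp add: S_def)
  have S_eq: "S Z v = S Z0 v" if "full Z" "Z \<subseteq> Z0" for Z v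
  proof -
    have le: "card (S Z w) \<le> card (S Z0 w)" for w
      using S_mono[OF that(2)] finS card_mono by blast
    have "card (S Z v) = card (S Z0 v)"
      using le[of True] le[of False] Z0(2)[OF that(1)] by (cases v) auto
    then show ?thesis using S_mono[OF that(2)] finS card_subset_eq by blast
  qed
  have "\<forall>v. \<exists>d. d \<in> S Z0 v" using S_ne[OF Z0(1)] by blast
  then obtain c where "\<And>v. c v \<in> S Z0 v" by metis
  then have c: "eventually (good Z v (c v)) p" if "full Z" "Z \<subseteq> Z0" for Z v
    using S_eq[OF that] by (auto simp: S_def)
  define cell where "cell J \<sigma> = {x \<in> Z0. \<forall>j\<in>J. P (\<sigma> j) j x \<and> \<kappa> j x = c (\<sigma> j)}" for J \<sigma>
  define ok where "ok J \<longleftrightarrow> finite J \<and> J \<subseteq> I \<and> (\<forall>\<sigma>. full (cell J \<sigma>))" for J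
  have step: "\<exists>J'. ok J' \<and> J \<subset> J'" if J: "ok J" for J
  proof -
    \<comment> \<open>A cell depends only on the values of \<open>\<sigma>\<close> in
      \<open>J\<close>. Hence there are finitely many cells, and \<open>p\<close>-many rows are good
      for all of them and for both values.\<close>
    let ?F = "cell J ` (J \<rightarrow>\<^sub>E UNIV)"
    have cellF: "cell J \<sigma> \<in> ?F" for \<sigma>
    proof
      show "restrict \<sigma> J \<in> J \<rightarrow>\<^sub>E UNIV" by simp
    qed (auto simp: cell_def)
    have "finite ?F" using J by (simp add: ok_def finite_PiE)
    moreover have "eventually (\<lambda>i. \<forall>v\<in>UNIV. good Z v (c v) i) p" if "Z \<in> ?F" for Z
    proof -
      have "full Z" "Z \<subseteq> Z0" using that J by (auto simp: ok_def cell_def)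
      then show ?thesis by (intro eventually_ball_finite ballI c) auto
    qed
    ultimately have "eventually (\<lambda>i. \<forall>Z\<in>?F. \<forall>v\<in>UNIV. good Z v (c v) i) p"
      by (rule eventually_ball_finite[OF _ ballI])
    moreover have "eventually (\<lambda>i. i \<notin> J) p" using J cof by (simp add: ok_def)
    ultimately have "eventually (\<lambda>i. (\<forall>Z\<in>?F. \<forall>v\<in>UNIV. good Z v (c v) i) \<and> i \<notin> J \<and> i \<in> I) p"
      using evI by eventually_elim auto
    then obtain i where i: "\<forall>Z\<in>?F. \<forall>v\<in>UNIV. good Z v (c v) i" "i \<notin> J" "i \<in> I"
      using p(2) eventually_happens' by blast
    have "full (cell (insert i J) \<sigma>)" for \<sigma>
    proof -
      have "good (cell J \<sigma>) (\<sigma> i) (c (\<sigma> i)) i" using i cellF by blast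
      moreover have "{x \<in> cell J \<sigma>. P (\<sigma> i) i x \<and> \<kappa> i x = c (\<sigma> i)} = cell (insert i J) \<sigma>"
        by (auto simp: cell_def)
      ultimately show ?thesis by (simp add: good_def)
    qed
    then have "ok (insert i J)" using J i by (simp add: ok_def)
    then show ?thesis using i by blast
  qed
  have "ok {}" using Z0 by (simp add: ok_def cell_def)
  then obtain H where H: "\<And>n. ok (H n)" "\<And>n::nat. H n \<subset> H (Suc n)"
    using dependent_nat_choice[of "\<lambda>_. ok" "\<lambda>_ J J'. J \<subset> J'"] step by metis
  have mono: "H m \<subseteq> H n" if "m \<le> n" for m n
    using H(2) that by (metis lift_Suc_mono_le psubset_imp_subset)
  have "n \<le> card (H n)" for n
  proof (induction n)
    case (Suc n)
    have "card (H n) < card (H (Suc n))" using H by (meson ok_def psubset_card_mono)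
    then show ?case using Suc by simp
  qed simp
  then have "infinite (\<Union>n. H n)"
    by (metis UNIV_I UN_upper card_mono not_less_eq_eq order_trans)
  moreover have "(\<Union>n. H n) \<subseteq> I" using H(1) by (auto simp: ok_def)
  moreover have "\<exists>x. \<forall>j\<in>J. P (\<sigma> j) j x \<and> \<kappa> j x = c (\<sigma> j)" if "finite J" "J \<subseteq> (\<Union>n. H n)" for J \<sigma>
  proof -
    have "\<exists>n. J \<subseteq> H n" using that
    proof (induction J)
      case (insert j J)
      then obtain m n where "J \<subseteq> H m" "j \<in> H n" by auto
      then have "insert j J \<subseteq> H (max m n)"
        using mono[of m "max m n"] mono[of n "max m n"] by auto
      then show ?case ..
    qed simp
    then obtain n where n: "J \<subseteq> H n" ..
    have "cell (H n) \<sigma> \<noteq> {}" using H(1)[of n] full_empty by (metis ok_def)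
    then show ?thesis using n by (auto simp: cell_def)
  qed
  ultimately show ?thesis using that[of "\<Union>n. H n" c] by meson
qed

section \<open>Independence sets in compact spaces\<close>

lemma (in group_action) image_inv_eq:
  assumes "g \<in> carrier G" "A \<subseteq> E"
  shows "\<phi> (inv g) ` A = {x \<in> E. \<phi> g x \<in> A}"
proof -
  have G: "inv g \<in> carrier G" "inv (inv g) = g"
    using assms(1) group_hom by (auto simp: group_hom_def group.inv_closed group.inv_inv)
  have "\<phi> (inv g) y \<in> E \<and> \<phi> g (\<phi> (inv g) y) = y" if "y \<in> A" for y
    using orbit_sym_aux[OF G(1), of y] element_image[OF G(1)] that assms(2) by (auto simp: G(2))
  moreover have "x \<in> \<phi> (inv g) ` A" if "x \<in> E" "\<phi> g x \<in> A" for x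
    using orbit_sym_aux[OF assms(1) that(1) refl] that(2) by (metis imageI)
  ultimately show ?thesis by auto
qed

text \<open>Translates by inverses are preimages. Independence thus becomes a statement about a
  matrix with rows \<open>j\<close> and columns \<open>y\<close>, as in
  \<open>independence_ramsey\<close>.\<close>

lemma independence_set_iff:
  assumes "group_action G (topspace Y) \<phi>" "A0 \<subseteq> topspace Y" "A1 \<subseteq> topspace Y"
  shows "independence_set G Y \<phi> A0 A1 I \<longleftrightarrow> I \<subseteq> carrier G \<and>
    (\<forall>J \<sigma>. finite J \<and> J \<subseteq> I \<longrightarrow> (\<exists>y\<in>topspace Y. \<forall>j\<in>J. \<phi> j y \<in> (if \<sigma> j then A1 else A0)))"
proof (cases "I \<subseteq> carrier G")
  case True
  interpret group_action G "topspace Y" \<phi> by fact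
  have eq: "topspace Y \<inter> (\<Inter>j\<in>J. \<phi> (inv\<^bsub>G\<^esub> j) ` B j) = {y \<in> topspace Y. \<forall>j\<in>J. \<phi> j y \<in> B j}"
    if "J \<subseteq> I" "\<And>j. B j \<subseteq> topspace Y" for J B
  proof -
    have "\<phi> (inv\<^bsub>G\<^esub> j) ` B j = {y \<in> topspace Y. \<phi> j y \<in> B j}" if "j \<in> J" for j
      using \<open>J \<subseteq> I\<close> True that \<open>B j \<subseteq> topspace Y\<close> by (intro image_inv_eq) auto
    then show ?thesis by auto
  qed
  have B: "(if b then A1 else A0) \<subseteq> topspace Y" for b using assms(2,3) by simp
  show ?thesis
    unfolding independence_set_def
  proof (intro conj_cong refl all_cong1 imp_cong)
    fix J \<sigma> assume "finite J \<and> J \<subseteq> I"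
    then show "topspace Y \<inter> (\<Inter>j\<in>J. \<phi> (inv\<^bsub>G\<^esub> j) ` (if \<sigma> j then A1 else A0)) \<noteq> {} \<longleftrightarrow>
        (\<exists>y\<in>topspace Y. \<forall>j\<in>J. \<phi> j y \<in> (if \<sigma> j then A1 else A0))"
      by (subst eq) (use B in blast)+
  qed
qed (auto simp: independence_set_def)

text \<open>Otherwise compactness covers \<open>K0 \<times> K1\<close> by finitely many open boxes
  whose sides have no infinite independence set. When each entry is coloured by the sides that
  contain it, \<open>independence_ramsey\<close> finds a box that does have one.\<close>

lemma IT_pair_exists:
  assumes ga: "group_action G (topspace Y) \<phi>" and Y: "compact_space Y"
    and K: "closedin Y K0" "closedin Y K1"
    and ind: "independence_set G Y \<phi> K0 K1 I" and I: "infinite I"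
  shows "\<exists>x\<in>K0. \<exists>y\<in>K1. IT_pair G Y \<phi> x y"
proof (rule ccontr)
  assume "\<not> ?thesis"
  then have no_IT: "\<not> IT_pair G Y \<phi> x y" if "x \<in> K0" "y \<in> K1" for x y
    using that by blast
  note KY = closedin_subset[OF K(1)] closedin_subset[OF K(2)]
  define small where "small p \<longleftrightarrow> openin Y (fst p) \<and> openin Y (snd p) \<and>
    \<not> (\<exists>I. infinite I \<and> independence_set G Y \<phi> (fst p) (snd p) I)" for p
  have cover: "\<exists>p. small p \<and> x \<in> fst p \<and> y \<in> snd p" if xy: "x \<in> K0" "y \<in> K1" for x y
  proof -
    have "x \<in> topspace Y" "y \<in> topspace Y" using KY xy by blast+
    then obtain U0 U1 where "openin Y U0 \<and> openin Y U1 \<and> x \<in> U0 \<and> y \<in> U1"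
      "\<not> (\<exists>I. infinite I \<and> independence_set G Y \<phi> U0 U1 I)"
      using no_IT[OF xy] unfolding IT_pair_def by metis
    then show ?thesis by (intro exI[of _ "(U0, U1)"]) (simp add: small_def)
  qed
  have K01: "compactin (prod_topology Y Y) (K0 \<times> K1)"
    using K Y by (simp add: compactin_Times closedin_compact_space)
  have "\<exists>W. finite W \<and> W \<subseteq> (\<lambda>p. fst p \<times> snd p) ` Collect small \<and> K0 \<times> K1 \<subseteq> \<Union>W"
  proof (rule compactinD[OF K01])
    show "openin (prod_topology Y Y) U" if "U \<in> (\<lambda>p. fst p \<times> snd p) ` Collect small" for U
      using that by (elim imageE) (simp add: small_def openin_prod_Times_iff)
    show "K0 \<times> K1 \<subseteq> \<Union>((\<lambda>p. fst p \<times> snd p) ` Collect small)"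
    proof
      fix z assume "z \<in> K0 \<times> K1"
      then obtain p where "small p" "z \<in> fst p \<times> snd p"
        using cover[of "fst z" "snd z"] unfolding mem_Times_iff by blast
      then show "z \<in> \<Union>((\<lambda>p. fst p \<times> snd p) ` Collect small)"
        by (intro UN_I CollectI)
    qed
  qed
  then obtain W where W: "finite W" "W \<subseteq> (\<lambda>p. fst p \<times> snd p) ` Collect small" "K0 \<times> K1 \<subseteq> \<Union>W"
    by (elim exE conjE)
  from finite_subset_image[OF W(1,2)] obtain Q
    where Q: "Q \<subseteq> Collect small" "finite Q" "W = (\<lambda>p. fst p \<times> snd p) ` Q"
    by (elim exE conjE)
  have small: "small p" if "p \<in> Q" for p using subsetD[OF Q(1) that] by simp
  have cover: "K0 \<times> K1 \<subseteq> (\<Union>p\<in>Q. fst p \<times> snd p)" using W(3) Q(3) by simp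
  interpret group_action G "topspace Y" \<phi> by (rule ga)
  have IG: "I \<subseteq> carrier G" and indI: "\<And>J \<sigma>. finite J \<Longrightarrow> J \<subseteq> I \<Longrightarrow>
      \<exists>y\<in>topspace Y. \<forall>j\<in>J. \<phi> j y \<in> (if \<sigma> j then K1 else K0)"
    using ind KY independence_set_iff[OF ga] by auto
  define P where "P v j y \<longleftrightarrow> y \<in> topspace Y \<and> \<phi> j y \<in> (if v then K1 else K0)" for v j y
  \<comment> \<open>The colour records which sides of which boxes of the cover contain the point
    \<open>\<phi> j y\<close>.\<close>
  define \<kappa> where "\<kappa> j y = ({p \<in> Q. \<phi> j y \<in> fst p}, {p \<in> Q. \<phi> j y \<in> snd p})" for j y
  have indP: "\<exists>y. \<forall>j\<in>J. P (\<sigma> j) j y" if "finite J" "J \<subseteq> I" for J \<sigma>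
    using indI[OF that, of \<sigma>] unfolding P_def by blast
  have \<kappa>Pow: "finite (Pow Q \<times> Pow Q)" "\<And>j y. \<kappa> j y \<in> Pow Q \<times> Pow Q"
    using Q(2) by (auto simp: \<kappa>_def)
  have "\<exists>I' c. I' \<subseteq> I \<and> infinite I' \<and>
      (\<forall>J \<sigma>. finite J \<longrightarrow> J \<subseteq> I' \<longrightarrow> (\<exists>y. \<forall>j\<in>J. P (\<sigma> j) j y \<and> \<kappa> j y = c (\<sigma> j)))"
    by (rule independence_ramsey[of I "Pow Q \<times> Pow Q" \<kappa> P, OF I \<kappa>Pow indP]) blast+
  then obtain I' c where I': "I' \<subseteq> I" "infinite I'"
    and "\<forall>J \<sigma>. finite J \<longrightarrow> J \<subseteq> I' \<longrightarrow> (\<exists>y. \<forall>j\<in>J. P (\<sigma> j) j y \<and> \<kappa> j y = c (\<sigma> j))"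
    by (elim exE conjE)
  then have c: "\<exists>y. \<forall>j\<in>J. P (\<sigma> j) j y \<and> \<kappa> j y = c (\<sigma> j)" if "finite J" "J \<subseteq> I'" for J \<sigma>
    using that by simp
  obtain i where i: "i \<in> I'" using I'(2) by (metis all_not_in_conv finite.emptyI)
  have "\<exists>y. P v i y \<and> \<kappa> i y = c v" for v using c[of "{i}" "\<lambda>_. v"] i by auto
  then obtain z where z: "\<And>v. P v i (z v)" "\<And>v. \<kappa> i (z v) = c v" by metis
  have "\<phi> i (z False) \<in> K0" "\<phi> i (z True) \<in> K1"
    using z(1)[of False] z(1)[of True] by (auto simp: P_def)
  \<comment> \<open>A single row picks the box. Since the colours supplied by \<open>c\<close>
    depend only on the value, entries of value \<open>False\<close> lie in its first side and those
    of value \<open>True\<close> in its second.\<close>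
  then have "(\<phi> i (z False), \<phi> i (z True)) \<in> (\<Union>p\<in>Q. fst p \<times> snd p)" using cover by blast
  then obtain p where p: "p \<in> Q" "\<phi> i (z False) \<in> fst p" "\<phi> i (z True) \<in> snd p"
    by (elim UN_E) (simp only: mem_Times_iff fst_conv snd_conv)
  have c0: "p \<in> fst (c False)" and c1: "p \<in> snd (c True)"
    using p unfolding z(2)[symmetric] by (auto simp: \<kappa>_def)
  have "independence_set G Y \<phi> (fst p) (snd p) I'"
  proof (subst independence_set_iff[OF ga]; (intro conjI allI impI)?)
    show "fst p \<subseteq> topspace Y" "snd p \<subseteq> topspace Y" using small[OF p(1)] openin_subset unfolding small_def by blast+
    show "I' \<subseteq> carrier G" using I' IG by blast
    fix J \<sigma> assume "finite J \<and> J \<subseteq> I'"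
    then have J: "finite J" "J \<subseteq> I'" by auto
    obtain y where y: "\<forall>j\<in>J. P (\<sigma> j) j y \<and> \<kappa> j y = c (\<sigma> j)" using c[OF J] by blast
    show "\<exists>y\<in>topspace Y. \<forall>j\<in>J. \<phi> j y \<in> (if \<sigma> j then snd p else fst p)"
    \<comment> \<open>The empty pattern does not constrain \<open>y\<close>, which may lie outside
      the space; a point of the space is then supplied by \<open>z\<close>.\<close>
    proof (cases "J = {}")
      case True
      then show ?thesis using z(1)[of True] by (auto simp: P_def)
    next
      case False
      then have "y \<in> topspace Y" using y by (auto simp: P_def)
      moreover have "\<phi> j y \<in> (if \<sigma> j then snd p else fst p)" if "j \<in> J" for j
      proof -
        have "c (\<sigma> j) = \<kappa> j y" using y that by simp
        then have "fst (c (\<sigma> j)) = {p \<in> Q. \<phi> j y \<in> fst p}" "snd (c (\<sigma> j)) = {p \<in> Q. \<phi> j y \<in> snd p}"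
          by (simp_all add: \<kappa>_def)
        then show ?thesis using c0 c1 by (cases "\<sigma> j") auto
      qed
      ultimately show ?thesis by blast
    qed
  qed
  then have "\<exists>I. infinite I \<and> independence_set G Y \<phi> (fst p) (snd p) I"
    using I'(2) by (intro exI conjI)
  then show False using small[OF p(1)] unfolding small_def by (elim conjE notE)
qed

section \<open>Tame functions and shattered matrices\<close>

lemma mdist_funspace_ge:
  assumes "f \<in> mspace (funspace S m)" "g \<in> mspace (funspace S m)" "x \<in> S"
  shows "mdist m (f x) (g x) \<le> mdist (funspace S m) f g"
proof -
  interpret Metric_space "mspace m" "mdist m" by simp
  have fg: "f \<in> fspace S" "g \<in> fspace S" and S: "S \<noteq> {}" using assms by auto
  have "mdist m (f x) (g x) \<le> (SUP u\<in>S. mdist m (f u) (g u))"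
    by (rule cSUP_upper[OF assms(3) bdd_above_dist[OF fg S]])
  also have "\<dots> = fdist S f g" using fg S by (simp add: fdist_def)
  finally show ?thesis by simp
qed

text \<open>Every finite set of rows \<open>k\<close> is shattered by the columns \<open>n\<close> of the membership matrix of
  \<^const>\<open>set_decode\<close>, so \<open>range g\<close> is an independence set.\<close>

lemma tame_function_shatters:
  fixes G (structure) and g p :: "nat \<Rightarrow> 'g"
  assumes f: "f \<in> tame_functions G T" and T: "topspace T = carrier G"
    and g: "\<And>k. g k \<in> carrier G" and p: "\<And>n. p n \<in> carrier G"
    and val: "\<And>k n. \<bar>f (g k \<otimes> p n) - (if k \<in> set_decode n then \<beta> else \<alpha>)\<bar> \<le> d"
  shows "\<bar>\<alpha> - \<beta>\<bar> \<le> 2 * d"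
proof (rule ccontr)
  assume gap: "\<not> ?thesis"
  obtain Y :: "'g set set topology" and \<phi> \<nu> f' where c: "compactification G T \<nu> Y \<phi>"
    and tame: "tame_space G Y \<phi>" and f': "continuous_map Y euclideanreal f'"
    and ff': "\<And>x. x \<in> carrier G \<Longrightarrow> f x = f' (\<nu> x)"
    using f unfolding tame_functions_def by blast
  have Y: "compact_space Y" and ga: "group_action G (topspace Y) \<phi>" and em: "embedding_map T Y \<nu>"
    and eq: "\<And>g x. g \<in> carrier G \<Longrightarrow> x \<in> carrier G \<Longrightarrow> \<phi> g (\<nu> x) = \<nu> (g \<otimes> x)"
    using c by (auto simp: compactification_def continuous_action_def)
  interpret group_action G "topspace Y" \<phi> by (rule ga)
  have G: "group G" using group_hom by (simp add: group_hom_def)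
  have gp: "g k \<otimes> p n \<in> carrier G" for k n using g p G by (simp add: group.is_monoid monoid.m_closed)
  have \<nu>: "\<nu> x \<in> topspace Y" if "x \<in> carrier G" for x
    using embedding_map_mem[OF em] T that by blast
  \<comment> \<open>Rows \<open>k\<close> and \<open>l\<close> differ in the column that decodes to
    \<open>{k}\<close>, because the intervals of radius \<open>d\<close> around
    \<open>\<alpha>\<close> and \<open>\<beta>\<close> are disjoint. Hence \<open>range g\<close> is
    infinite.\<close>
  have "inj g"
  proof (rule injI, rule ccontr)
    fix k l assume "g k = g l" "k \<noteq> l"
    moreover obtain m where "set_decode m = {k}"
      using set_encode_inverse[of "{k}"] by blast
    ultimately show False using val[of k m] val[of l m] gap by auto
  qed
  \<comment> \<open>As \<open>\<alpha>\<close> and \<open>\<beta>\<close> are more than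
    \<open>2 * d\<close> apart, \<open>f'\<close> separates the points of \<open>K \<alpha>\<close>
    from those of \<open>K \<beta>\<close>; closedness serves the compactness argument.\<close>
  define K where "K v = {y \<in> topspace Y. f' y \<in> {v - d..v + d}}" for v
  have K: "closedin Y (K v)" for v
    unfolding K_def by (rule closedin_continuous_map_preimage[OF f']) simp
  have KY: "K v \<subseteq> topspace Y" for v by (auto simp: K_def)
  have "independence_set G Y \<phi> (K \<alpha>) (K \<beta>) (range g)"
    unfolding independence_set_iff[OF ga KY KY]
  proof (intro conjI allI impI)
    show "range g \<subseteq> carrier G" using g by blast
    fix J and \<sigma> :: "'g \<Rightarrow> bool" assume J: "finite J \<and> J \<subseteq> range g"
    \<comment> \<open>The column is the code of the set of rows on which the pattern asks for
      \<open>\<beta>\<close>, a finite set since \<open>g\<close> is injective.\<close>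
    define n where "n = set_encode {k. g k \<in> J \<and> \<sigma> (g k)}"
    have "finite (g -` J)" using J \<open>inj g\<close> by (simp add: finite_vimageI)
    then have "finite {k. g k \<in> J \<and> \<sigma> (g k)}" by (rule rev_finite_subset) auto
    then have n: "set_decode n = {k. g k \<in> J \<and> \<sigma> (g k)}" by (simp add: n_def)
    have "\<phi> j (\<nu> (p n)) \<in> (if \<sigma> j then K \<beta> else K \<alpha>)" if j: "j \<in> J" for j
    proof -
      obtain k where k: "j = g k" using j J by blast
      have "f' (\<nu> (g k \<otimes> p n)) = f (g k \<otimes> p n)" using ff' gp by simp
      then show ?thesis
        using val[of k n] j \<nu>[OF gp] unfolding k eq[OF g p] by (auto simp: K_def n abs_le_iff)
    qed
    then show "\<exists>y\<in>topspace Y. \<forall>j\<in>J. \<phi> j y \<in> (if \<sigma> j then K \<beta> else K \<alpha>)"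
      using \<nu>[OF p] by blast
  qed
  then obtain x y where xy: "x \<in> K \<alpha>" "y \<in> K \<beta>" "IT_pair G Y \<phi> x y"
    using IT_pair_exists[OF ga Y K K _ range_inj_infinite[OF \<open>inj g\<close>]] by blast
  then have "f' x \<noteq> f' y" using gap by (auto simp: K_def)
  then show False using tame xy(3) f' unfolding tame_space_def by metis
qed

section \<open>Embeddings and homogeneity\<close>

lemma univ_induced [simp]: "univ (induced A X) = X"
  by (simp add: induced_def)

lemma interp_induced [simp]: "interp (induced A X) R = {xs \<in> interp A R. set xs \<subseteq> X}"
  by (simp add: induced_def)

lemma embeddingsI:
  assumes "f \<in> univ A \<rightarrow>\<^sub>E univ B" "inj_on f (univ A)"
    "\<And>R xs. set xs \<subseteq> univ A \<Longrightarrow> xs \<in> interp A R \<longleftrightarrow> map f xs \<in> interp B R"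
  shows "f \<in> embeddings A B"
  using assms by (simp add: embeddings_def)

lemma embeddingsD:
  assumes "f \<in> embeddings A B"
  shows "f \<in> univ A \<rightarrow>\<^sub>E univ B" "inj_on f (univ A)"
    "\<And>R xs. set xs \<subseteq> univ A \<Longrightarrow> map f xs \<in> interp B R \<longleftrightarrow> xs \<in> interp A R"
    "\<And>x. x \<in> univ A \<Longrightarrow> f x \<in> univ B"
    "f ` univ A \<subseteq> univ B"
  using assms by (auto simp: embeddings_def)

lemma compose_embeddings:
  assumes f: "f \<in> embeddings A B" and g: "g \<in> embeddings B C"
  shows "compose (univ A) g f \<in> embeddings A C"
proof (rule embeddingsI)
  show "compose (univ A) g f \<in> univ A \<rightarrow>\<^sub>E univ C"
    using embeddingsD(4)[OF f] embeddingsD(4)[OF g] by (auto simp: compose_def)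
  have "inj_on (g \<circ> f) (univ A)"
    using embeddingsD(2,5)[OF f] embeddingsD(2)[OF g] by (meson comp_inj_on inj_on_subset)
  then show "inj_on (compose (univ A) g f) (univ A)"
    by (auto simp: inj_on_def compose_eq)
  fix R xs assume xs: "set xs \<subseteq> univ A"
  then have "map (compose (univ A) g f) xs = map g (map f xs)"
    by (auto simp: compose_eq)
  moreover have "set (map f xs) \<subseteq> univ B" using xs embeddingsD(5)[OF f] by auto
  ultimately show "xs \<in> interp A R \<longleftrightarrow> map (compose (univ A) g f) xs \<in> interp C R"
    using xs embeddingsD(3)[OF f] embeddingsD(3)[OF g] by metis
qed

lemma restrict_embedding:
  assumes f: "f \<in> embeddings A B" and X: "X \<subseteq> univ A"
  shows "restrict f X \<in> embeddings (induced A X) B"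
proof (rule embeddingsI)
  show "restrict f X \<in> univ (induced A X) \<rightarrow>\<^sub>E univ B"
    using embeddingsD(4)[OF f] X by auto
  show "inj_on (restrict f X) (univ (induced A X))"
    using embeddingsD(2)[OF f] X inj_on_subset by auto
  fix R xs assume xs: "set xs \<subseteq> univ (induced A X)"
  then have "map (restrict f X) xs = map f xs" "set xs \<subseteq> univ A" using X by auto
  then show "xs \<in> interp (induced A X) R \<longleftrightarrow> map (restrict f X) xs \<in> interp B R"
    using xs embeddingsD(3)[OF f] by (metis (mono_tags, lifting) interp_induced mem_Collect_eq univ_induced)
qed

lemma isomorphism_onto_image:
  assumes f: "f \<in> embeddings A B"
  shows "f \<in> isomorphisms A (induced B (f ` univ A))"
proof -
  have "f \<in> embeddings A (induced B (f ` univ A))"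
  proof (rule embeddingsI)
    show "f \<in> univ A \<rightarrow>\<^sub>E univ (induced B (f ` univ A))" "inj_on f (univ A)"
      using embeddingsD[OF f] by auto
    show "xs \<in> interp A R \<longleftrightarrow> map f xs \<in> interp (induced B (f ` univ A)) R"
      if "set xs \<subseteq> univ A" for R xs
      using that embeddingsD(3)[OF f that] by auto
  qed
  then show ?thesis by (simp add: isomorphisms_def)
qed

lemma inverse_isomorphism:
  assumes "f \<in> isomorphisms A B"
  shows "restrict (inv_into (univ A) f) (univ B) \<in> isomorphisms B A"
proof -
  have f: "f \<in> embeddings A B" and im: "f ` univ A = univ B"
    using assms by (auto simp: isomorphisms_def)
  let ?g = "restrict (inv_into (univ A) f) (univ B)"
  have gA: "?g y \<in> univ A" and fg: "f (?g y) = y" if "y \<in> univ B" for y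
    using that im by (auto simp: inv_into_into f_inv_into_f)
  have gf: "?g (f x) = x" if "x \<in> univ A" for x
    using that im embeddingsD(2)[OF f] by auto
  have "?g \<in> embeddings B A"
  proof (rule embeddingsI)
    show "?g \<in> univ B \<rightarrow>\<^sub>E univ A" using gA by auto
    show "inj_on ?g (univ B)" by (rule inj_on_inverseI) (rule fg)
    fix R ys assume ys: "set ys \<subseteq> univ B"
    have "map f (map ?g ys) = ys" using ys fg by (auto simp: subset_iff intro!: map_idI)
    moreover have "set (map ?g ys) \<subseteq> univ A" using ys gA by auto
    ultimately show "ys \<in> interp B R \<longleftrightarrow> map ?g ys \<in> interp A R"
      using embeddingsD(3)[OF f, of "map ?g ys" R] by simp
  qed
  moreover have "?g ` univ B = univ A"
  proof
    show "?g ` univ B \<subseteq> univ A" using gA by blast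
    show "univ A \<subseteq> ?g ` univ B"
    proof
      fix x assume x: "x \<in> univ A"
      then have "f x \<in> univ B" using im by blast
      then show "x \<in> ?g ` univ B" using gf[OF x] by (metis image_eqI)
    qed
  qed
  ultimately show ?thesis by (simp add: isomorphisms_def)
qed

lemma compose_isomorphisms:
  assumes f: "f \<in> isomorphisms A B" and g: "g \<in> isomorphisms B C"
  shows "compose (univ A) g f \<in> isomorphisms A C"
proof -
  have "compose (univ A) g f ` univ A = g ` f ` univ A" by (auto simp: compose_eq)
  then show ?thesis using f g compose_embeddings by (auto simp: isomorphisms_def)
qed

text \<open>The inverse of \<open>f\<close> followed by \<open>f'\<close>. Ultrahomogeneity and the
  Hrushovski property speak of isomorphisms between substructures, whereas the argument works with
  embeddings.\<close>

lemma isomorphism_between_images: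
  assumes f: "f \<in> embeddings A B" and f': "f' \<in> embeddings A B"
  shows "\<exists>p \<in> isomorphisms (induced B (f ` univ A)) (induced B (f' ` univ A)). \<forall>x \<in> univ A. p (f x) = f' x"
proof
  let ?g = "restrict (inv_into (univ A) f) (f ` univ A)"
  let ?p = "compose (f ` univ A) f' ?g"
  show "?p \<in> isomorphisms (induced B (f ` univ A)) (induced B (f' ` univ A))"
    using compose_isomorphisms[OF inverse_isomorphism[OF isomorphism_onto_image[OF f]]
        isomorphism_onto_image[OF f']] by simp
  show "\<forall>x \<in> univ A. ?p (f x) = f' x"
    using embeddingsD(2)[OF f] by (simp add: compose_eq)
qed

lemma ultrahomogeneous_extend:
  assumes F: "ultrahomogeneous F" and A: "finite (univ A)"
    and f: "f \<in> embeddings A F" and f': "f' \<in> embeddings A F"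
  obtains g where "g \<in> automorphisms F" "\<And>x. x \<in> univ A \<Longrightarrow> g (f x) = f' x"
proof -
  obtain p where p: "p \<in> isomorphisms (induced F (f ` univ A)) (induced F (f' ` univ A))"
    "\<And>x. x \<in> univ A \<Longrightarrow> p (f x) = f' x"
    using isomorphism_between_images[OF f f'] by blast
  have "f ` univ A \<subseteq> univ F \<and> f' ` univ A \<subseteq> univ F \<and> finite (f ` univ A) \<and> finite (f' ` univ A)
      \<and> p \<in> isomorphisms (induced F (f ` univ A)) (induced F (f' ` univ A))"
    using A embeddingsD(5)[OF f] embeddingsD(5)[OF f'] p(1) by simp
  then have "\<exists>g\<in>automorphisms F. \<forall>x \<in> f ` univ A. g x = p x"
    by (rule F[unfolded ultrahomogeneous_def, THEN spec, THEN spec, THEN spec, THEN mp])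
  then obtain g where "g \<in> automorphisms F" "\<forall>x \<in> f ` univ A. g x = p x"
    by (elim bexE)
  then show ?thesis using p(2) that by simp
qed

text \<open>The given embeddings of the finite stages need not agree. By ultrahomogeneity an
  automorphism corrects each to extend the one chosen before, and the union of the corrected maps
  embeds \<open>D\<close>.\<close>

lemma embedding_of_chain:
  assumes F: "ultrahomogeneous F"
    and X: "\<And>n. finite (X n)" "\<And>n. X n \<subseteq> X (Suc n)" "(\<Union>n. X n) = univ D"
    and emb: "\<And>n::nat. embeddings (induced D (X n)) F \<noteq> {}"
  shows "embeddings D F \<noteq> {}"
proof -
  have step: "\<exists>f'. f' \<in> embeddings (induced D (X (Suc n))) F \<and> (\<forall>x\<in>X n. f' x = f x)"
    if f: "f \<in> embeddings (induced D (X n)) F" for f n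
  proof -
    obtain f' where f': "f' \<in> embeddings (induced D (X (Suc n))) F" using emb by blast
    have "induced (induced D (X (Suc n))) (X n) = induced D (X n)"
      using X(2)[of n] by (auto simp: induced_def fun_eq_iff)
    then have "restrict f' (X n) \<in> embeddings (induced D (X n)) F"
      using restrict_embedding[OF f', of "X n"] X(2)[of n] by simp
    moreover have "finite (univ (induced D (X n)))" using X(1) by simp
    ultimately obtain g where g: "g \<in> automorphisms F"
      "\<And>x. x \<in> univ (induced D (X n)) \<Longrightarrow> g (restrict f' (X n) x) = f x"
      using ultrahomogeneous_extend[OF F _ _ f] by metis
    have "compose (X (Suc n)) g f' \<in> embeddings (induced D (X (Suc n))) F"
      using compose_embeddings[OF f', of g F] g(1) by (simp add: isomorphisms_def)
    moreover have "compose (X (Suc n)) g f' x = f x" if "x \<in> X n" for x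
      using g(2)[of x] that X(2)[of n] by (auto simp: compose_eq)
    ultimately show ?thesis by blast
  qed
  have "\<exists>e. \<forall>n. e n \<in> embeddings (induced D (X n)) F \<and> (\<forall>x\<in>X n. e (Suc n) x = e n x)"
  proof (rule dependent_nat_choice)
    show "\<exists>f. f \<in> embeddings (induced D (X 0)) F" using emb[of 0] by blast
  qed (rule step)
  then obtain e where e: "\<And>n. e n \<in> embeddings (induced D (X n)) F"
      "\<And>n x. x \<in> X n \<Longrightarrow> e (Suc n) x = e n x"
    by blast
  have Xmono: "X m \<subseteq> X n" if "m \<le> n" for m n
    using X(2) that by (rule lift_Suc_mono_le)
  have eq: "e n x = e m x" if "m \<le> n" "x \<in> X m" for m n x
    using that(1)
  proof (induction n rule: dec_induct)
    case (step n)
    then have "x \<in> X n" using Xmono that(2) by blast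
    then show ?case using e(2) step by simp
  qed simp
  define h where "h = (\<lambda>x\<in>univ D. e (LEAST n. x \<in> X n) x)"
  have h: "h x = e n x" if "x \<in> X n" for x n
  proof -
    have "x \<in> X (LEAST n. x \<in> X n)" "(LEAST n. x \<in> X n) \<le> n" using that by (auto intro: LeastI Least_le)
    moreover have "x \<in> univ D" using that X(3) by blast
    ultimately show ?thesis using eq by (simp add: h_def)
  qed
  \<comment> \<open>Injectivity and relations involve finitely many points at a time, so they can be
    checked within one stage.\<close>
  have cover: "\<exists>n. Y \<subseteq> X n" if "finite Y" "Y \<subseteq> univ D" for Y
    using that
  proof (induction Y)
    case (insert y Y)
    then obtain m where "Y \<subseteq> X m" by auto
    moreover obtain n where "y \<in> X n" using insert.prems X(3) by blast
    ultimately have "insert y Y \<subseteq> X (max m n)"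
      using Xmono[of m "max m n"] Xmono[of n "max m n"] by auto
    then show ?case ..
  qed simp
  have "h \<in> embeddings D F"
  proof (rule embeddingsI)
    show "h \<in> univ D \<rightarrow>\<^sub>E univ F"
    proof (rule PiE_I)
      fix x assume "x \<in> univ D"
      then obtain n where "x \<in> X n" using X(3) by blast
      then show "h x \<in> univ F" using h embeddingsD(4)[OF e(1)] by simp
    qed (simp add: h_def)
    show "inj_on h (univ D)"
    proof (rule inj_onI)
      fix x y assume xy: "x \<in> univ D" "y \<in> univ D" "h x = h y"
      then have "finite {x, y}" "{x, y} \<subseteq> univ D" by simp_all
      from cover[OF this] obtain n where "x \<in> X n" "y \<in> X n" by blast
      then show "x = y" using h xy(3) embeddingsD(2)[OF e(1)[of n]] by (simp add: inj_on_def)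
    qed
    fix R xs assume xs: "set xs \<subseteq> univ D"
    obtain n where n: "set xs \<subseteq> X n" using cover xs by blast
    have "map h xs = map (e n) xs" using n h by auto
    then show "xs \<in> interp D R \<longleftrightarrow> map h xs \<in> interp F R"
      using embeddingsD(3)[OF e(1)[of n], of xs R] n by (metis (mono_tags, lifting) interp_induced mem_Collect_eq univ_induced)
  qed
  then show ?thesis by blast
qed

section \<open>Infinitely many disjoint copies\<close>

text \<open>The free union of countably many copies of \<open>B\<close>. Copy number and point are
  coded in one natural number because the Henson property is stated for structures on subsets of
  \<open>nat\<close>. The empty tuple of a nullary relation belongs to all copies at once.\<close>

definition copies :: "('r, nat) struc \<Rightarrow> ('r, nat) struc" where
  "copies B = \<lparr>univ = prod_encode ` (UNIV \<times> univ B),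
     interp = (\<lambda>R. \<Union>n. map (\<lambda>b. prod_encode (n, b)) ` interp B R)\<rparr>"

lemma univ_copies: "univ (copies B) = prod_encode ` (UNIV \<times> univ B)"
  by (simp add: copies_def)

lemma interp_copies:
  "zs \<in> interp (copies B) R \<longleftrightarrow> (\<exists>n xs. zs = map (\<lambda>b. prod_encode (n, b)) xs \<and> xs \<in> interp B R)"
  by (auto simp: copies_def)

lemma in_interp_copiesI:
  "xs \<in> interp B R \<Longrightarrow> map (\<lambda>b. prod_encode (n, b)) xs \<in> interp (copies B) R"
  unfolding interp_copies by (rule exI[of _ n], rule exI[of _ xs]) simp

lemma prod_encode_in_copies [simp]: "prod_encode (n, b) \<in> univ (copies B) \<longleftrightarrow> b \<in> univ B"
  by (auto simp: univ_copies inj_eq inj_prod_encode)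

text \<open>The copy number can be read off every tuple except the empty one, which nullary
  relations may contain.\<close>

lemma map_prod_encode_eq_iff:
  "map (\<lambda>b. prod_encode (n, b)) xs = map (\<lambda>b. prod_encode (m, b)) ys \<longleftrightarrow> xs = ys \<and> (n = m \<or> xs = [])"
  (is "?l \<longleftrightarrow> ?r")
proof
  assume ?l
  from arg_cong[OF this, of "map (snd \<circ> prod_decode)"] have "xs = ys" by (simp add: o_def)
  moreover have "n = m" if "xs \<noteq> []"
    using \<open>?l\<close> that \<open>xs = ys\<close> by (cases xs) auto
  ultimately show ?r by blast
qed auto

lemma is_structure_copies:
  assumes "is_structure ar B"
  shows "is_structure ar (copies B)"
  using assms by (auto simp: is_structure_def interp_copies) blast

lemma copy_embedding: "(\<lambda>b\<in>univ B. prod_encode (n, b)) \<in> embeddings B (copies B)"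
proof (rule embeddingsI)
  fix R xs assume xs: "set xs \<subseteq> univ B"
  have "map (\<lambda>b\<in>univ B. prod_encode (n, b)) xs = map (\<lambda>b. prod_encode (n, b)) xs"
    using xs by auto
  then show "xs \<in> interp B R \<longleftrightarrow> map (\<lambda>b\<in>univ B. prod_encode (n, b)) xs \<in> interp (copies B) R"
    by (simp add: interp_copies map_prod_encode_eq_iff del: map_eq_conv)
qed (auto simp: inj_on_def)

text \<open>Peels off copy number \<open>n\<close>, so that free joint embedding, which joins two
  structures at a time, can be applied inductively.\<close>

lemma split_last_copy:
  assumes B: "is_structure ar B"
  defines "X \<equiv> \<lambda>n. prod_encode ` ({..<n} \<times> univ B)"
  shows "embeddings (induced (copies B) (X (Suc n)))
           (disjoint_union (induced (copies B) (X n)) B) \<noteq> {}"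
proof -
  define f where "f = (\<lambda>z\<in>X (Suc n). case prod_decode z of (i, b) \<Rightarrow> if i < n then Inl z else Inr b)"
  have X_iff: "prod_encode (i, b) \<in> X m \<longleftrightarrow> i < m \<and> b \<in> univ B" for i b m
    by (auto simp: X_def inj_eq inj_prod_encode)
  have X_cases: "\<exists>i b. z = prod_encode (i, b) \<and> i < m \<and> b \<in> univ B" if "z \<in> X m" for z m
    using that by (auto simp: X_def)
  have f_Inl: "f z = Inl z" if "z \<in> X n" for z
    using X_cases[OF that] by (auto simp: f_def X_iff)
  have f_Inr: "f (prod_encode (n, b)) = Inr b" if "b \<in> univ B" for b
    using that by (simp add: f_def X_iff)
  have cases: "z \<in> X n \<or> (\<exists>b\<in>univ B. z = prod_encode (n, b))" if "z \<in> X (Suc n)" for z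
    using X_cases[OF that] by (auto simp: X_iff less_Suc_eq)
  have XS: "X n \<subseteq> X (Suc n)" by (auto simp: X_def)
  have uni: "univ (disjoint_union (induced (copies B) (X n)) B) = X n <+> univ B"
    by (simp add: disjoint_union_def)
  have int: "ys \<in> interp (disjoint_union (induced (copies B) (X n)) B) R \<longleftrightarrow>
     (\<exists>zs. ys = map Inl zs \<and> zs \<in> interp (copies B) R \<and> set zs \<subseteq> X n) \<or>
     (\<exists>xs. ys = map Inr xs \<and> xs \<in> interp B R)" for ys R
    by (auto simp: disjoint_union_def)
  have "f \<in> embeddings (induced (copies B) (X (Suc n))) (disjoint_union (induced (copies B) (X n)) B)"
  proof (rule embeddingsI)
    show "f \<in> univ (induced (copies B) (X (Suc n))) \<rightarrow>\<^sub>E univ (disjoint_union (induced (copies B) (X n)) B)"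
    proof (rule PiE_I)
      fix z assume "z \<in> univ (induced (copies B) (X (Suc n)))"
      then show "f z \<in> univ (disjoint_union (induced (copies B) (X n)) B)"
        using cases[of z] f_Inl f_Inr by (auto simp: uni)
    qed (simp add: f_def)
    show "inj_on f (univ (induced (copies B) (X (Suc n))))"
    proof (rule inj_onI)
      fix z w assume "z \<in> univ (induced (copies B) (X (Suc n)))" "w \<in> univ (induced (copies B) (X (Suc n)))"
        and eq: "f z = f w"
      then show "z = w" using cases[of z] cases[of w] by (auto simp: f_Inl f_Inr)
    qed
    fix R zs assume zs: "set zs \<subseteq> univ (induced (copies B) (X (Suc n)))"
    show "zs \<in> interp (induced (copies B) (X (Suc n))) R \<longleftrightarrow>
        map f zs \<in> interp (disjoint_union (induced (copies B) (X n)) B) R"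
    proof
      assume "zs \<in> interp (induced (copies B) (X (Suc n))) R"
      then obtain m xs where m: "zs = map (\<lambda>b. prod_encode (m, b)) xs" "xs \<in> interp B R"
        by (auto simp: interp_copies)
      have xsB: "set xs \<subseteq> univ B" using m(2) B by (auto simp: is_structure_def)
      \<comment> \<open>For the empty tuple \<open>m\<close> is arbitrary and may exceed
        \<open>n\<close>; the tuple is then treated as one of \<open>B\<close>.\<close>
      consider "m < n" | "m = n \<or> xs = []"
        using zs m(1) by (cases xs) (auto simp: X_iff less_Suc_eq)
      then show "map f zs \<in> interp (disjoint_union (induced (copies B) (X n)) B) R"
      proof cases
        case 1
        then have "set zs \<subseteq> X n" using xsB m(1) by (auto simp: X_iff)
        moreover from this have "map f zs = map Inl zs" using f_Inl by auto
        moreover have "zs \<in> interp (copies B) R" using in_interp_copiesI[OF m(2)] m(1) by metis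
        ultimately show ?thesis unfolding int by blast
      next
        case 2
        then have "map f zs = map Inr xs" using xsB f_Inr m(1) by auto
        then show ?thesis using m(2) unfolding int by blast
      qed
    next
      assume "map f zs \<in> interp (disjoint_union (induced (copies B) (X n)) B) R"
      then consider ys where "map f zs = map Inl ys" "ys \<in> interp (copies B) R" "set ys \<subseteq> X n"
        | xs where "map f zs = map Inr xs" "xs \<in> interp B R" unfolding int by blast
      then have "zs \<in> interp (copies B) R"
      proof cases
        case 1
        have "map f ys = map f zs" using 1 f_Inl by auto
        moreover have "inj_on f (set ys \<union> set zs)"
          using \<open>inj_on f (univ (induced (copies B) (X (Suc n))))\<close> 1(3) zs XS
          by (auto elim!: inj_on_subset)
        ultimately have "ys = zs" by (meson inj_on_map_eq_map)
        then show ?thesis using 1(2) by simp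
      next
        case 2
        have xsB: "set xs \<subseteq> univ B" using 2(2) B by (auto simp: is_structure_def)
        have "map f (map (\<lambda>b. prod_encode (n, b)) xs) = map f zs"
          using 2(1) xsB f_Inr by auto
        moreover have "inj_on f (set (map (\<lambda>b. prod_encode (n, b)) xs) \<union> set zs)"
          using \<open>inj_on f (univ (induced (copies B) (X (Suc n))))\<close> zs xsB
          by (auto elim!: inj_on_subset simp: X_iff)
        ultimately have "zs = map (\<lambda>b. prod_encode (n, b)) xs" by (metis inj_on_map_eq_map)
        then show ?thesis using in_interp_copiesI[OF 2(2)] by metis
      qed
      then show "zs \<in> interp (induced (copies B) (X (Suc n))) R" using zs by simp
    qed
  qed
  then show ?thesis by blast
qed

text \<open>The first \<open>n\<close> copies embed by induction on \<open>n\<close>, through free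
  joint embedding; homogeneity then passes from these finite stages to their union.\<close>

lemma copies_embeddable:
  assumes F: "ultrahomogeneous F" and fje: "free_joint_embedding ar F" and B: "B \<in> age ar F"
  shows "embeddings (copies B) F \<noteq> {}"
proof -
  define X where "X n = prod_encode ` ({..<n} \<times> univ B)" for n
  have B': "is_structure ar B" "finite (univ B)" "embeddings B F \<noteq> {}"
    using B by (auto simp: age_def)
  have fin: "finite (X n)" for n using B'(2) by (simp add: X_def)
  show ?thesis
  proof (rule embedding_of_chain[OF F fin])
    show "X n \<subseteq> X (Suc n)" for n by (auto simp: X_def)
    show "(\<Union>n. X n) = univ (copies B)" by (auto simp: X_def univ_copies)
    show "embeddings (induced (copies B) (X n)) F \<noteq> {}" for n
    proof (induction n)
      case 0
      obtain f where f: "f \<in> embeddings B F" using B'(3) by blast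
      \<comment> \<open>The empty map is constantly \<open>undefined\<close> as an extensional
        function. Nullary relations still have to agree, which follows from the embedding of
        \<open>B\<close>.\<close>
      have "(\<lambda>_. undefined) \<in> embeddings (induced (copies B) (X 0)) F"
      proof (rule embeddingsI)
        fix R xs assume "set xs \<subseteq> univ (induced (copies B) (X 0))"
        then have "xs = []" by (simp add: X_def)
        then show "xs \<in> interp (induced (copies B) (X 0)) R \<longleftrightarrow> map (\<lambda>_. undefined) xs \<in> interp F R"
          using embeddingsD(3)[OF f, of "[]" R] by (auto simp: interp_copies)
      qed (auto simp: X_def)
      then show ?case by blast
    next
      case (Suc n)
      have "induced (copies B) (X n) \<in> age ar F"
        using is_structure_copies[OF B'(1)] fin Suc by (auto simp: age_def is_structure_def)
      then have "disjoint_union (induced (copies B) (X n)) B \<in> age ar F"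
        using fje B unfolding free_joint_embedding_def by blast
      then obtain g where "g \<in> embeddings (disjoint_union (induced (copies B) (X n)) B) F"
        by (auto simp: age_def)
      then show ?case
        using split_last_copy[OF B'(1), of n] compose_embeddings unfolding X_def by blast
    qed
  qed
qed

text \<open>No tuple of a relation meets two copies, so automorphisms can be chosen independently in
  each copy.\<close>

lemma copywise_automorphism:
  assumes s: "\<And>i. s i \<in> automorphisms B"
  defines "tw \<equiv> \<lambda>z\<in>univ (copies B). case prod_decode z of (i, b) \<Rightarrow> prod_encode (i, s i b)"
  shows "tw \<in> automorphisms (copies B)" "\<And>i b. b \<in> univ B \<Longrightarrow> tw (prod_encode (i, b)) = prod_encode (i, s i b)"
proof -
  show tw: "tw (prod_encode (i, b)) = prod_encode (i, s i b)" if "b \<in> univ B" for i b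
    using that by (simp add: tw_def)
  have sE: "s i \<in> embeddings B B" and sim: "s i ` univ B = univ B" for i
    using s by (auto simp: isomorphisms_def)
  have cases: "\<exists>i b. z = prod_encode (i, b) \<and> b \<in> univ B" if "z \<in> univ (copies B)" for z
    using that by (auto simp: univ_copies)
  have inj: "inj_on tw (univ (copies B))"
  proof (rule inj_onI)
    fix z w assume zw: "z \<in> univ (copies B)" "w \<in> univ (copies B)" "tw z = tw w"
    then obtain i b j c where "z = prod_encode (i, b)" "b \<in> univ B" "w = prod_encode (j, c)" "c \<in> univ B"
      using cases by metis
    then show "z = w"
      using zw(3) embeddingsD(2)[OF sE] by (auto simp: tw inj_eq inj_prod_encode dest: inj_onD)
  qed
  have emb: "tw \<in> embeddings (copies B) (copies B)"
  proof (rule embeddingsI)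
    show "tw \<in> univ (copies B) \<rightarrow>\<^sub>E univ (copies B)"
    proof (rule PiE_I)
      fix z assume "z \<in> univ (copies B)"
      then show "tw z \<in> univ (copies B)" using cases[of z] embeddingsD(4)[OF sE] by (auto simp: tw)
    qed (simp add: tw_def)
    show "inj_on tw (univ (copies B))" by (rule inj)
    fix R zs assume zs: "set zs \<subseteq> univ (copies B)"
    have map_tw: "map tw (map (\<lambda>b. prod_encode (m, b)) xs) = map (\<lambda>b. prod_encode (m, b)) (map (s m) xs)"
      if "set xs \<subseteq> univ B" for m xs
      using that tw by auto
    show "zs \<in> interp (copies B) R \<longleftrightarrow> map tw zs \<in> interp (copies B) R"
    proof
      assume "zs \<in> interp (copies B) R"
      then obtain m xs where m: "zs = map (\<lambda>b. prod_encode (m, b)) xs" "xs \<in> interp B R"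
        by (auto simp: interp_copies)
      have xs: "set xs \<subseteq> univ B" using zs m(1) by auto
      then have "map (s m) xs \<in> interp B R" using m(2) embeddingsD(3)[OF sE] by blast
      then show "map tw zs \<in> interp (copies B) R" using in_interp_copiesI map_tw[OF xs] m(1) by metis
    next
      assume "map tw zs \<in> interp (copies B) R"
      then obtain m ys where m: "map tw zs = map (\<lambda>b. prod_encode (m, b)) ys" "ys \<in> interp B R"
        by (auto simp: interp_copies)
      \<comment> \<open>\<open>tw\<close> keeps the copy number, so all of \<open>zs\<close> lies in
        copy \<open>m\<close> and is determined by its second coordinates.\<close>
      define xs where "xs = map (snd \<circ> prod_decode) zs"
      have "prod_encode (m, snd (prod_decode z)) = z" if zzs: "z \<in> set zs" for z
      proof -
        obtain i b where z: "z = prod_encode (i, b)" "b \<in> univ B" using cases zzs zs by blast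
        have "tw z \<in> set (map (\<lambda>b. prod_encode (m, b)) ys)"
          using zzs unfolding m(1)[symmetric] by simp
        then show ?thesis using z by (auto simp: tw inj_eq inj_prod_encode)
      qed
      then have zs_eq: "zs = map (\<lambda>b. prod_encode (m, b)) xs" by (simp add: xs_def map_idI)
      have xs: "set xs \<subseteq> univ B" using zs zs_eq by auto
      have "map (\<lambda>b. prod_encode (m, b)) (map (s m) xs) = map (\<lambda>b. prod_encode (m, b)) ys"
        using m(1) map_tw[OF xs, of m] unfolding zs_eq by (simp only:)
      then have "map (s m) xs = ys" unfolding map_prod_encode_eq_iff by blast
      then have "xs \<in> interp B R" using m(2) embeddingsD(3)[OF sE xs] by metis
      then show "zs \<in> interp (copies B) R" using in_interp_copiesI zs_eq by metis
    qed
  qed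
  have "z \<in> tw ` univ (copies B)" if z: "z \<in> univ (copies B)" for z
  proof -
    obtain i b where "z = prod_encode (i, b)" "b \<in> univ B" using cases[OF z] by blast
    moreover from this obtain c where "c \<in> univ B" "b = s i c" using sim by blast
    ultimately show ?thesis using tw by (metis image_eqI prod_encode_in_copies)
  qed
  then have "tw ` univ (copies B) = univ (copies B)" using embeddingsD(5)[OF emb] by blast
  then show "tw \<in> automorphisms (copies B)" using emb by (simp add: isomorphisms_def)
qed

text \<open>The Henson property for \<open>copies B\<close> gives an embedding such that every
  copywise automorphism, conjugated by it, extends to \<open>F\<close>.\<close>

lemma twistable_copies_nat:
  fixes B :: "('r, nat) struc"
  assumes F: "ultrahomogeneous F" and fje: "free_joint_embedding ar F" and hen: "henson ar F"
    and B: "B \<in> age ar F"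
  obtains e where "\<And>i::nat. e i \<in> embeddings B F"
    "\<And>s. (\<And>i. s i \<in> automorphisms B) \<Longrightarrow>
       \<exists>g \<in> automorphisms F. \<forall>i. \<forall>b \<in> univ B. g (e i b) = e i (s i b)"
proof -
  let ?D = "copies B"
  have "is_structure ar ?D \<and> countable (univ ?D) \<and> embeddings ?D F \<noteq> {}"
    using B copies_embeddable[OF F fje B] is_structure_copies by (auto simp: age_def)
  then have "\<exists>h \<in> embeddings ?D F. \<forall>s \<in> automorphisms (induced F (h ` univ ?D)).
      \<exists>g \<in> automorphisms F. \<forall>x \<in> h ` univ ?D. g x = s x"
    by (rule hen[unfolded henson_def, THEN spec, THEN mp])
  then obtain h where h: "h \<in> embeddings ?D F"
    and ext: "\<And>s. s \<in> automorphisms (induced F (h ` univ ?D)) \<Longrightarrow>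
      \<exists>g \<in> automorphisms F. \<forall>x \<in> h ` univ ?D. g x = s x" by blast
  define e where "e i = compose (univ B) h (\<lambda>b\<in>univ B. prod_encode (i, b))" for i
  have e_eq: "e i b = h (prod_encode (i, b))" if "b \<in> univ B" for i b
    using that by (simp add: e_def compose_eq)
  show thesis
  proof (rule that)
    show "e i \<in> embeddings B F" for i
      unfolding e_def by (rule compose_embeddings[OF copy_embedding h])
    fix s :: "nat \<Rightarrow> nat \<Rightarrow> nat" assume s: "\<And>i. s i \<in> automorphisms B"
    define tw where "tw = (\<lambda>z\<in>univ ?D. case prod_decode z of (i, b) \<Rightarrow> prod_encode (i, s i b))"
    have tw: "tw \<in> automorphisms ?D" "\<And>i b. b \<in> univ B \<Longrightarrow> tw (prod_encode (i, b)) = prod_encode (i, s i b)"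
      using copywise_automorphism[of s B, OF s] unfolding tw_def by blast+
    let ?hD = "h ` univ ?D"
    let ?h' = "restrict (inv_into (univ ?D) h) ?hD"
    have h_iso: "h \<in> isomorphisms ?D (induced F ?hD)" by (rule isomorphism_onto_image[OF h])
    have "compose ?hD h (compose ?hD tw ?h') \<in> automorphisms (induced F ?hD)"
      using compose_isomorphisms[OF compose_isomorphisms[OF inverse_isomorphism[OF h_iso] tw(1)] h_iso]
      by simp
    then obtain g where g: "g \<in> automorphisms F"
      "\<And>x. x \<in> ?hD \<Longrightarrow> g x = compose ?hD h (compose ?hD tw ?h') x" using ext by blast
    have gh: "g (h z) = h (tw z)" if "z \<in> univ ?D" for z
      using that g(2)[of "h z"] embeddingsD(2)[OF h] by (simp add: compose_eq)
    have "g (e i b) = e i (s i b)" if "b \<in> univ B" for i b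
    proof -
      have "s i b \<in> univ B" using s[of i] that by (auto simp: isomorphisms_def)
      then show ?thesis using that gh tw(2) by (simp add: e_eq)
    qed
    then show "\<exists>g \<in> automorphisms F. \<forall>i. \<forall>b \<in> univ B. g (e i b) = e i (s i b)"
      using g(1) by blast
  qed
qed

text \<open>Transport along an injection into \<open>nat\<close>: the Hrushovski property ranges
  over structures on natural numbers, while \<open>B\<close> may have any type.\<close>

lemma nat_copy:
  fixes B :: "('r, 'c) struc"
  assumes "is_structure ar B" "countable (univ B)"
  obtains B' :: "('r, nat) struc" and f where "is_structure ar B'" "f \<in> isomorphisms B B'"
proof -
  obtain \<psi> :: "'c \<Rightarrow> nat" where \<psi>: "inj_on \<psi> (univ B)"
    using assms(2) by (auto simp: countable_def)
  define B' where "B' = \<lparr>univ = \<psi> ` univ B, interp = (\<lambda>R. map \<psi> ` interp B R)\<rparr>"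
  have B: "set xs \<subseteq> univ B" "length xs = ar R" if "xs \<in> interp B R" for xs R
    using assms(1) that by (auto simp: is_structure_def)
  have "is_structure ar B'"
    using B by (fastforce simp: is_structure_def B'_def)
  moreover have "restrict \<psi> (univ B) \<in> embeddings B B'"
  proof (rule embeddingsI)
    fix R xs assume xs: "set xs \<subseteq> univ B"
    then have eq: "map (restrict \<psi> (univ B)) xs = map \<psi> xs" by auto
    have "xs = ys" if "map \<psi> xs = map \<psi> ys" "ys \<in> interp B R" for ys
    proof (rule inj_on_map_eq_map[THEN iffD1, OF _ that(1)])
      show "inj_on \<psi> (set xs \<union> set ys)"
        using xs B(1)[OF that(2)] by (intro inj_on_subset[OF \<psi>]) simp
    qed
    then show "xs \<in> interp B R \<longleftrightarrow> map (restrict \<psi> (univ B)) xs \<in> interp B' R"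
      unfolding eq by (auto simp: B'_def)
  qed (use \<psi> in \<open>auto simp: B'_def inj_on_def\<close>)
  then have "restrict \<psi> (univ B) \<in> isomorphisms B B'"
    by (simp add: isomorphisms_def B'_def)
  ultimately show thesis using that by blast
qed

text \<open>The copies \<open>e i\<close> of \<open>B\<close> sit inside copies of the finite structure given by the Hrushovski
  property, where \<open>a\<close> and \<open>a'\<close> are conjugate. The Henson property then allows us to exchange them
  in an arbitrary set of copies simultaneously.\<close>

lemma exchangeable_copies:
  fixes F :: "('r, 'a) struc" and A :: "('r, 'b) struc" and B :: "('r, 'c) struc"
  assumes F: "ultrahomogeneous F" and fje: "free_joint_embedding ar F" and hen: "henson ar F"
    and hru: "hrushovski ar F" and B: "B \<in> age ar F"
  shows "\<exists>e :: nat \<Rightarrow> 'c \<Rightarrow> 'a. (\<forall>i. e i \<in> embeddings B F) \<and>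
    (\<forall>a \<in> embeddings A B. \<forall>a' \<in> embeddings A B. \<forall>S. \<exists>g \<in> automorphisms F. \<forall>i. \<forall>x \<in> univ A.
       g (e i (a x)) = e i (if i \<in> S then a' x else a x))"
proof -
  have B': "is_structure ar B" "finite (univ B)" "embeddings B F \<noteq> {}" using B by (auto simp: age_def)
  obtain B1 :: "('r, nat) struc" and f where B1: "is_structure ar B1" and f: "f \<in> isomorphisms B B1"
    using nat_copy[OF B'(1) countable_finite[OF B'(2)]] by blast
  have "finite (univ B1)" using f finite_imageI[OF B'(2), of f] by (simp add: isomorphisms_def)
  moreover have "embeddings B1 F \<noteq> {}"
    using inverse_isomorphism[OF f] B'(3) compose_embeddings by (fastforce simp: isomorphisms_def)
  ultimately have "B1 \<in> age ar F" using B1 by (simp add: age_def)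
  then have "\<exists>B2 :: ('r, nat) struc. B2 \<in> age ar F \<and>
      (\<exists>h \<in> embeddings B1 B2. \<forall>X Y p. X \<subseteq> h ` univ B1 \<and> Y \<subseteq> h ` univ B1 \<and>
         p \<in> isomorphisms (induced B2 X) (induced B2 Y) \<longrightarrow>
         (\<exists>t \<in> automorphisms B2. \<forall>x \<in> X. t x = p x))"
    by (rule hru[unfolded hrushovski_def, THEN spec, THEN mp])
  then obtain B2 :: "('r, nat) struc" and h where B2: "B2 \<in> age ar F" and h: "h \<in> embeddings B1 B2"
    and ext: "\<And>X Y p. X \<subseteq> h ` univ B1 \<and> Y \<subseteq> h ` univ B1 \<and>
         p \<in> isomorphisms (induced B2 X) (induced B2 Y) \<Longrightarrow> \<exists>t \<in> automorphisms B2. \<forall>x \<in> X. t x = p x"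
    by (elim exE conjE bexE) blast
  obtain e where e: "\<And>i::nat. e i \<in> embeddings B2 F"
    and tw: "\<And>s. (\<And>i. s i \<in> automorphisms B2) \<Longrightarrow>
       \<exists>g \<in> automorphisms F. \<forall>i. \<forall>b \<in> univ B2. g (e i b) = e i (s i b)"
    using twistable_copies_nat[OF F fje hen B2] by metis
  \<comment> \<open>\<open>B\<close> enters \<open>B2\<close> through its copy \<open>B1\<close>.
    Its image lies in that of \<open>h\<close>, so partial isomorphisms within it extend to
    automorphisms of \<open>B2\<close>.\<close>
  define k where "k = compose (univ B) h f"
  have k: "k \<in> embeddings B B2"
    unfolding k_def using f h by (intro compose_embeddings) (auto simp: isomorphisms_def)
  have kim: "k ` univ B \<subseteq> h ` univ B1"
    using f by (auto simp: k_def compose_eq isomorphisms_def)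
  show ?thesis
  proof (intro exI conjI allI ballI)
    show "compose (univ B) (e i) k \<in> embeddings B F" for i using k e by (rule compose_embeddings)
    fix a a' and S :: "nat set"
    assume a: "a \<in> embeddings A B" and a': "a' \<in> embeddings A B"
    have ka: "compose (univ A) k a \<in> embeddings A B2" and ka': "compose (univ A) k a' \<in> embeddings A B2"
      using a a' k by (blast intro: compose_embeddings)+
    obtain p where p: "p \<in> isomorphisms (induced B2 (compose (univ A) k a ` univ A))
        (induced B2 (compose (univ A) k a' ` univ A))"
      and pa: "\<And>x. x \<in> univ A \<Longrightarrow> p (compose (univ A) k a x) = compose (univ A) k a' x"
      using isomorphism_between_images[OF ka ka'] by blast
    have "compose (univ A) k b ` univ A \<subseteq> h ` univ B1" if "b \<in> embeddings A B" for b
    proof -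
      have "compose (univ A) k b ` univ A = k ` b ` univ A" by (auto simp: compose_eq)
      then show ?thesis using kim embeddingsD(5)[OF that] by blast
    qed
    from this[OF a] this[OF a'] obtain t where t: "t \<in> automorphisms B2"
      "\<forall>y \<in> compose (univ A) k a ` univ A. t y = p y" using ext p by metis
    have tk: "t (k (a x)) = k (a' x)" if "x \<in> univ A" for x
      using t(2) pa[OF that] that by (simp add: compose_eq)
    \<comment> \<open>The identity, restricted because automorphisms are extensional, acts on the
      copies outside \<open>S\<close>.\<close>
    define idB where "idB = (\<lambda>b\<in>univ B2. b)"
    have "idB \<in> automorphisms B2"
    proof -
      have "idB \<in> embeddings B2 B2"
      proof (rule embeddingsI)
        fix R xs assume "set xs \<subseteq> univ B2"
        then have "map idB xs = xs" by (auto simp: idB_def intro!: map_idI)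
        then show "xs \<in> interp B2 R \<longleftrightarrow> map idB xs \<in> interp B2 R" by simp
      qed (auto simp: idB_def)
      then show ?thesis by (auto simp: isomorphisms_def idB_def)
    qed
    then have "(if i \<in> S then t else idB) \<in> automorphisms B2" for i using t(1) by simp
    from tw[of "\<lambda>i. if i \<in> S then t else idB", OF this]
    obtain g where g: "g \<in> automorphisms F"
      "\<And>i b. b \<in> univ B2 \<Longrightarrow> g (e i b) = e i ((if i \<in> S then t else idB) b)" by blast
    have "g (compose (univ B) (e i) k (a x)) = compose (univ B) (e i) k (if i \<in> S then a' x else a x)"
      if x: "x \<in> univ A" for i x
    proof -
      have "a x \<in> univ B" "a' x \<in> univ B"
        using embeddingsD(4)[OF a x] embeddingsD(4)[OF a' x] by blast+
      then show ?thesis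
        using g(2)[of "k (a x)" i] tk[OF x] embeddingsD(4)[OF k] by (simp add: compose_eq idB_def)
    qed
    then show "\<exists>g \<in> automorphisms F. \<forall>i. \<forall>x \<in> univ A.
        g (compose (univ B) (e i) k (a x)) = compose (univ B) (e i) k (if i \<in> S then a' x else a x)"
      using g(1) by blast
  qed
qed

section \<open>The theorem\<close>

text \<open>The product of \<open>BijGroup\<close> is composition on \<open>Bij\<close> only, so
  automorphisms are first shown to lie there.\<close>

lemma mult_aut_group:
  assumes "g \<in> automorphisms F" "p \<in> automorphisms F"
  shows "g \<otimes>\<^bsub>aut_group F\<^esub> p = compose (univ F) g p"
proof -
  have "automorphisms F \<subseteq> Bij (univ F)"
    by (auto simp: Bij_def bij_betw_def isomorphisms_def embeddings_def PiE_def)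
  then show ?thesis using assms by (auto simp: aut_group_def BijGroup_def)
qed

theorem theorem3p11:
  fixes ar :: "'r \<Rightarrow> nat"
    and F :: "('r, 'a) struc"
    and A :: "('r, 'b) struc"
    and B :: "('r, 'c) struc"
    and a0 :: "'b \<Rightarrow> 'a"
    and C :: "(('b \<Rightarrow> 'a) \<Rightarrow> real) set"
    and \<epsilon> :: real
  assumes "fraisse_structure ar F"
    and "henson ar F"
    and "hrushovski ar F"
    and "free_joint_embedding ar F"
    and "\<epsilon> > 0"
    and "A \<in> age ar F"
    and "B \<in> age ar F"
    and "a0 \<in> embeddings A F"
    and "finite C"
    and "\<And>c. c \<in> C \<Longrightarrow> finite_colouring F A c"
    and "\<And>c. c \<in> C \<Longrightarrow> colouring_on_group F A a0 c
           \<in> sup_nbhd (aut_group F) (tame_functions (aut_group F) (aut_topology F)) \<epsilon>"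
  shows "\<exists>h \<in> embeddings B F. \<forall>c \<in> C. \<forall>a \<in> embeddings A B. \<forall>a' \<in> embeddings A B.
           \<bar>c (compose (univ A) h a) - c (compose (univ A) h a')\<bar> \<le> 2 * \<epsilon>"
proof (rule ccontr)
  assume contr: "\<not> ?thesis"
  let ?G = "aut_group F"
  have F: "ultrahomogeneous F" using assms(1) by (simp add: fraisse_structure_def)
  have finA: "finite (univ A)" and finB: "finite (univ B)" using assms(6,7) by (auto simp: age_def)
  obtain e where e: "\<forall>i::nat. e i \<in> embeddings B F"
    and exch: "\<forall>a \<in> embeddings A B. \<forall>a' \<in> embeddings A B. \<forall>S. \<exists>g \<in> automorphisms F.
       \<forall>i. \<forall>x \<in> univ A. g (e i (a x)) = e i (if i \<in> S then a' x else a x)"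
    using exchangeable_copies[of F ar B A, OF F assms(4,2,3,7)] by (elim exE conjE)
  note e = e[rule_format]
  define bad where "bad h q \<longleftrightarrow> (case q of (c, a, a') \<Rightarrow> c \<in> C \<and> a \<in> embeddings A B \<and> a' \<in> embeddings A B \<and>
      \<bar>c (compose (univ A) h a) - c (compose (univ A) h a')\<bar> > 2 * \<epsilon>)" for h q
  have "\<exists>q. bad h q" if "h \<in> embeddings B F" for h
    using contr that unfolding bad_def by (simp add: not_le) blast
  then have "\<forall>i. \<exists>q. bad (e i) q" using e by blast
  from choice[OF this] obtain q where q: "\<And>i. bad (e i) (q i)" by blast
  \<comment> \<open>The label keeps both values of the colouring besides the bad triple. Its range
    is finite since \<open>C\<close>, \<open>embeddings A B\<close> and the images of the colourings
    are, so some label occurs in infinitely many copies.\<close>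
  define lab where "lab i = (case q i of (c, a, a') \<Rightarrow>
      (q i, c (compose (univ A) (e i) a), c (compose (univ A) (e i) a')))" for i
  have "range lab \<subseteq> (C \<times> embeddings A B \<times> embeddings A B) \<times>
      (\<Union>c\<in>C. c ` embeddings A F) \<times> (\<Union>c\<in>C. c ` embeddings A F)"
  proof
    fix l assume "l \<in> range lab"
    then obtain i where i: "l = lab i" by blast
    obtain c a a' where qi: "q i = (c, a, a')" by (cases "q i")
    have "c \<in> C" "a \<in> embeddings A B" "a' \<in> embeddings A B" using q[of i] by (simp_all add: bad_def qi)
    then show "l \<in> (C \<times> embeddings A B \<times> embeddings A B) \<times>
      (\<Union>c\<in>C. c ` embeddings A F) \<times> (\<Union>c\<in>C. c ` embeddings A F)"
      using compose_embeddings[OF _ e[of i]] unfolding i lab_def qi by auto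
  qed
  moreover have "finite (embeddings A B)"
  proof (rule finite_subset)
    show "embeddings A B \<subseteq> univ A \<rightarrow>\<^sub>E univ B" by (auto simp: embeddings_def)
    show "finite (univ A \<rightarrow>\<^sub>E univ B)" using finA finB by (simp add: finite_PiE)
  qed
  moreover have "finite (\<Union>c\<in>C. c ` embeddings A F)"
    using assms(9,10) by (simp add: finite_colouring_def)
  ultimately have "finite (range lab)" using assms(9) by (meson finite_SigmaI finite_subset)
  then obtain i0 where "infinite {i. lab i = lab i0}"
    using pigeonhole_infinite[of UNIV lab] by auto
  \<comment> \<open>\<open>r\<close> picks infinitely many copies with the same label; injectivity
    allows exchanges to be prescribed by the index \<open>n\<close>.\<close>
  then obtain r :: "nat \<Rightarrow> nat" where r: "inj r" "range r \<subseteq> {i. lab i = lab i0}"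
    using infinite_countable_subset by blast
  obtain c a a' where qi: "q i0 = (c, a, a')" by (cases "q i0")
  define \<alpha> where "\<alpha> = c (compose (univ A) (e i0) a)"
  define \<beta> where "\<beta> = c (compose (univ A) (e i0) a')"
  have cC: "c \<in> C" and a: "a \<in> embeddings A B" and a': "a' \<in> embeddings A B" and gap: "\<bar>\<alpha> - \<beta>\<bar> > 2 * \<epsilon>"
    using q[of i0] by (simp_all add: bad_def qi \<alpha>_def \<beta>_def)
  have \<alpha>: "c (compose (univ A) (e (r n)) a) = \<alpha>" and \<beta>: "c (compose (univ A) (e (r n)) a') = \<beta>" for n
  proof -
    have "lab (r n) = lab i0" using r(2) by blast
    moreover from this have "q (r n) = q i0" by (simp add: lab_def split: prod.splits)
    ultimately show "c (compose (univ A) (e (r n)) a) = \<alpha>" "c (compose (univ A) (e (r n)) a') = \<beta>"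
      by (simp_all add: lab_def qi \<alpha>_def \<beta>_def)
  qed
  \<comment> \<open>\<open>g k\<close> moves \<open>a\<close> to \<open>a'\<close> exactly in the
    copies \<open>r n\<close> with \<open>k \<in> set_decode n\<close>, so the columns
    \<open>n\<close> run through all finite sets of rows.\<close>
  have "\<forall>k. \<exists>g \<in> automorphisms F. \<forall>i. \<forall>x \<in> univ A.
      g (e i (a x)) = e i (if i \<in> r ` {n. k \<in> set_decode n} then a' x else a x)"
    by (intro allI exch[rule_format, OF a a'])
  then obtain g where g: "\<And>k. g k \<in> automorphisms F"
    and ge: "\<And>k i x. x \<in> univ A \<Longrightarrow>
      g k (e i (a x)) = e i (if i \<in> r ` {n. k \<in> set_decode n} then a' x else a x)" by metis
  \<comment> \<open>\<open>p n\<close> carries the base copy \<open>a0\<close> to \<open>a\<close>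
    in the copy \<open>r n\<close>. The colouring on the group at the product of \<open>g k\<close>
    and \<open>p n\<close> is then the matrix entry in row \<open>k\<close> and column
    \<open>n\<close>.\<close>
  have "\<exists>p \<in> automorphisms F. \<forall>x \<in> univ A. p (a0 x) = compose (univ A) (e (r n)) a x" for n
    using ultrahomogeneous_extend[OF F finA assms(8) compose_embeddings[OF a e]] by metis
  then obtain p where p: "\<And>n. p n \<in> automorphisms F"
    and pa: "\<And>n x. x \<in> univ A \<Longrightarrow> p n (a0 x) = compose (univ A) (e (r n)) a x" by metis
  have carr: "carrier ?G = automorphisms F" by (simp add: aut_group_def)
  have gp: "g k \<otimes>\<^bsub>?G\<^esub> p n = compose (univ F) (g k) (p n)" for k n
    by (rule mult_aut_group[OF g p])
  have gp_carr: "g k \<otimes>\<^bsub>?G\<^esub> p n \<in> carrier ?G" for k n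
    using compose_isomorphisms[OF p g] by (simp add: gp carr)
  have col: "colouring_on_group F A a0 c (g k \<otimes>\<^bsub>?G\<^esub> p n) = (if k \<in> set_decode n then \<beta> else \<alpha>)" for k n
  proof -
    have "compose (univ F) (g k) (p n) (a0 x) = e (r n) (if k \<in> set_decode n then a' x else a x)"
      if "x \<in> univ A" for x
      using that embeddingsD(4)[OF assms(8) that] pa[OF that] ge[OF that, of k "r n"] r(1)
      by (simp add: compose_eq inj_image_mem_iff)
    then have "compose (univ A) (g k \<otimes>\<^bsub>?G\<^esub> p n) a0 =
        compose (univ A) (e (r n)) (if k \<in> set_decode n then a' else a)"
      unfolding gp by (auto simp: compose_def restrict_def fun_eq_iff)
    then show ?thesis using gp_carr \<alpha> \<beta> by (simp add: colouring_on_group_def)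
  qed
  obtain f where f: "f \<in> tame_functions ?G (aut_topology F)"
    and cm: "colouring_on_group F A a0 c \<in> mspace (funspace (carrier ?G) euclidean_metric)"
    and dist: "mdist (funspace (carrier ?G) euclidean_metric) (colouring_on_group F A a0 c) f < \<epsilon>"
    using assms(11)[OF cC] unfolding sup_nbhd_def by blast
  have fm: "f \<in> mspace (funspace (carrier ?G) euclidean_metric)"
    using f unfolding tame_functions_def RUCb_def by blast
  have "\<bar>f x - colouring_on_group F A a0 c x\<bar> \<le> \<epsilon>" if "x \<in> carrier ?G" for x
    using mdist_funspace_ge[OF cm fm that] dist by (simp add: dist_real_def abs_minus_commute)
  then have "\<bar>f (g k \<otimes>\<^bsub>?G\<^esub> p n) - (if k \<in> set_decode n then \<beta> else \<alpha>)\<bar> \<le> \<epsilon>" for k n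
    using gp_carr col by metis
  then have "\<bar>\<alpha> - \<beta>\<bar> \<le> 2 * \<epsilon>"
    using tame_function_shatters[OF f topspace_aut_topology, of g p] g p carr by blast
  then show False using gap by simp
qed

end
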